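(* For a sequence $p=p(n)\in[0,1]$ let $G_n\sim G(n,p)$. (i) For each integer $d\geq 1$ there is a sequence $p(n)\in[0,1]$ such that $\mathrm{FOC}(G_n)$ spans a $d$-dimensional linear subspace of $\ell^{\infty}/c_0$. (ii) There is a sequence $p(n)\in[0,1]$ such that $\mathrm{FOC}(G_n)$ is totally bounded (in the norm of $\ell^\infty/c_0$) but spans an infinite-dimensional linear subspace of $\ell^{\infty}/c_0$. (iii) There is a sequence $p(n)\in[0,1]$ such that $\mathrm{FOC}(G_n)$ is not totally bounded.
   Context: $\ell^\infty$ is the Banach space of bounded real sequences $x=(x_n)_{n\in\mathbb{N}}$ with the sup norm, $c_0\subset\ell^\infty$ the subspace of sequences converging to $0$, and $\ell^\infty/c_0$ the quotient Banach space with norm $\|x+c_0\|=\limsup_n|x_n|$; $\pi:\ell^\infty\to\ell^\infty/c_0$ is the canonical projection. For a sequence $(D_n)_{n\in\mathbb{N}}$ of random structures, where $D_n$ is a random structure with domain $[n]=\{1,\dots,n\}$ over a relational signature, the first order complexity $\mathrm{FOC}(D_n)$ is the set $\{\pi((\Pr(D_n\models\varphi))_{n\in\mathbb{N}}) : \varphi \text{ a first order sentence}\}\subset\ell^\infty/c_0$. $G(n,p)$ is the binomial random graph: a random simple undirected graph on vertex set $[n]$ in which each of the $\binom n2$ possible edges is present independently with probability $p$; it is viewed as a structure over the signature consisting of equality and the adjacency relation. *)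

theory Defs
  imports "HOL-Analysis.Analysis" "HOL-Probability.Probability"
begin

section \<open>The space of bounded sequences modulo null sequences\<close>

text \<open>
  Since the topology of \<^typ>\<open>nat\<close> is discrete, \<^typ>\<open>nat \<Rightarrow>\<^sub>C real\<close> is the space of all bounded
  real sequences, and its norm is the supremum norm.
\<close>

definition c0 :: "(nat \<Rightarrow>\<^sub>C real) set" where
  "c0 = {x. (\<lambda>n. apply_bcontfun x n) \<longlonglongrightarrow> 0}"

lemma subspace_c0: "subspace c0"
proof (rule subspaceI)
  show "0 \<in> c0" by (simp add: c0_def)
next
  fix x y assume "x \<in> c0" "y \<in> c0"
  then show "x + y \<in> c0"
    using tendsto_add[of "apply_bcontfun x" 0 sequentially "apply_bcontfun y" 0]
    by (simp add: c0_def)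
next
  fix c x assume "x \<in> c0"
  then show "c *\<^sub>R x \<in> c0"
    using tendsto_mult_right_zero[of "apply_bcontfun x" sequentially c]
    by (simp add: c0_def)
qed

definition limsup_abs :: "(nat \<Rightarrow>\<^sub>C real) \<Rightarrow> real" where
  "limsup_abs x = real_of_ereal (limsup (\<lambda>n. ereal \<bar>apply_bcontfun x n\<bar>))"

lemma ereal_limsup_abs: "ereal (limsup_abs x) = limsup (\<lambda>n. ereal \<bar>apply_bcontfun x n\<bar>)"
proof -
  let ?L = "limsup (\<lambda>n. ereal \<bar>apply_bcontfun x n\<bar>)"
  have "?L \<le> ereal (norm x)"
    by (rule Limsup_bounded) (simp add: norm_bounded[of x, unfolded real_norm_def])
  moreover have "0 \<le> ?L"
    by (rule le_Limsup) auto
  ultimately show ?thesis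
    unfolding limsup_abs_def by (intro ereal_real') auto
qed

lemma limsup_abs_le_iff:
  "limsup_abs x \<le> c \<longleftrightarrow> (\<forall>e>0. \<forall>\<^sub>F n in sequentially. \<bar>apply_bcontfun x n\<bar> < c + e)"
proof -
  have "limsup_abs x \<le> c \<longleftrightarrow> limsup (\<lambda>n. ereal \<bar>apply_bcontfun x n\<bar>) \<le> ereal c"
    by (simp flip: ereal_limsup_abs)
  also have "\<dots> \<longleftrightarrow> (\<forall>y>ereal c. \<forall>\<^sub>F n in sequentially. ereal \<bar>apply_bcontfun x n\<bar> < y)"
    by (rule Limsup_le_iff)
  also have "\<dots> \<longleftrightarrow> (\<forall>e>0. \<forall>\<^sub>F n in sequentially. \<bar>apply_bcontfun x n\<bar> < c + e)"
  proof safe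
    fix e :: real assume *: "\<forall>y>ereal c. \<forall>\<^sub>F n in sequentially. ereal \<bar>apply_bcontfun x n\<bar> < y" "e > 0"
    then show "\<forall>\<^sub>F n in sequentially. \<bar>apply_bcontfun x n\<bar> < c + e"
      using *(1)[rule_format, of "ereal (c + e)"] by simp
  next
    fix y assume *: "\<forall>e>0. \<forall>\<^sub>F n in sequentially. \<bar>apply_bcontfun x n\<bar> < c + e" "ereal c < y"
    show "\<forall>\<^sub>F n in sequentially. ereal \<bar>apply_bcontfun x n\<bar> < y"
      using *(2) *(1)[rule_format, of "real_of_ereal y - c"] by (cases y) auto
  qed
  finally show ?thesis .
qed

lemma limsup_abs_nonneg: "0 \<le> limsup_abs x"
proof -
  have "0 \<le> limsup (\<lambda>n. ereal \<bar>apply_bcontfun x n\<bar>)"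
    by (rule le_Limsup) auto
  then show ?thesis by (simp flip: ereal_limsup_abs)
qed

lemma limsup_abs_less: "e > 0 \<Longrightarrow> \<forall>\<^sub>F n in sequentially. \<bar>apply_bcontfun x n\<bar> < limsup_abs x + e"
  using limsup_abs_le_iff[of x "limsup_abs x"] by simp

lemma limsup_abs_eq_0_iff: "limsup_abs x = 0 \<longleftrightarrow> x \<in> c0"
  using limsup_abs_le_iff[of x 0] limsup_abs_nonneg[of x]
  by (simp add: c0_def tendsto_iff dist_real_def)

lemma limsup_abs_add: "limsup_abs (x + y) \<le> limsup_abs x + limsup_abs y"
  unfolding limsup_abs_le_iff
proof safe
  fix e :: real assume "e > 0"
  then have "\<forall>\<^sub>F n in sequentially. \<bar>apply_bcontfun x n\<bar> < limsup_abs x + e / 2"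
       and "\<forall>\<^sub>F n in sequentially. \<bar>apply_bcontfun y n\<bar> < limsup_abs y + e / 2"
    by (simp_all add: limsup_abs_less)
  then show "\<forall>\<^sub>F n in sequentially. \<bar>apply_bcontfun (x + y) n\<bar> < limsup_abs x + limsup_abs y + e"
    by eventually_elim auto
qed

lemma limsup_abs_scaleR: "limsup_abs (c *\<^sub>R x) = \<bar>c\<bar> * limsup_abs x"
proof -
  have "ereal (limsup_abs (c *\<^sub>R x)) = limsup (\<lambda>n. ereal \<bar>c\<bar> * ereal \<bar>apply_bcontfun x n\<bar>)"
    by (simp add: ereal_limsup_abs abs_mult)
  also have "\<dots> = ereal \<bar>c\<bar> * limsup (\<lambda>n. ereal \<bar>apply_bcontfun x n\<bar>)"
    by (rule limsup_ereal_mult_left) auto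
  finally show ?thesis by (simp flip: ereal_limsup_abs)
qed

quotient_type linf_mod_c0 = "nat \<Rightarrow>\<^sub>C real" / "\<lambda>x y. x - y \<in> c0"
  morphisms rep_linf_mod_c0 linf_proj
proof (rule equivpI)
  show "reflp (\<lambda>x y. x - y \<in> c0)"
    by (rule reflpI) (simp add: subspace_0[OF subspace_c0])
  show "symp (\<lambda>x y. x - y \<in> c0)"
    by (rule sympI) (metis minus_diff_eq subspace_c0 subspace_neg)
  show "transp (\<lambda>x y. x - y \<in> c0)"
  proof (rule transpI)
    fix x y z assume "x - y \<in> c0" "y - z \<in> c0"
    then have "(x - y) + (y - z) \<in> c0" by (rule subspace_add[OF subspace_c0])
    then show "x - z \<in> c0" by simp
  qed
qed

instantiation linf_mod_c0 :: real_vector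
begin

lift_definition zero_linf_mod_c0 :: linf_mod_c0 is "0 :: nat \<Rightarrow>\<^sub>C real" .

lift_definition plus_linf_mod_c0 :: "linf_mod_c0 \<Rightarrow> linf_mod_c0 \<Rightarrow> linf_mod_c0" is "(+)"
  by (simp add: add_diff_add subspace_add[OF subspace_c0])

lift_definition minus_linf_mod_c0 :: "linf_mod_c0 \<Rightarrow> linf_mod_c0 \<Rightarrow> linf_mod_c0" is "(-)"
proof -
  fix x x' y y' :: "nat \<Rightarrow>\<^sub>C real" assume "x - x' \<in> c0" "y - y' \<in> c0"
  then have "(x - x') - (y - y') \<in> c0" by (rule subspace_diff[OF subspace_c0])
  then show "(x - y) - (x' - y') \<in> c0" by (simp add: algebra_simps)
qed

lift_definition uminus_linf_mod_c0 :: "linf_mod_c0 \<Rightarrow> linf_mod_c0" is uminus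
  by (metis minus_diff_minus subspace_c0 subspace_neg)

lift_definition scaleR_linf_mod_c0 :: "real \<Rightarrow> linf_mod_c0 \<Rightarrow> linf_mod_c0" is scaleR
  by (metis scaleR_diff_right subspace_c0 subspace_scale)

instance
  by standard (transfer; simp add: algebra_simps subspace_0[OF subspace_c0])+

end

instantiation linf_mod_c0 :: real_normed_vector
begin

lift_definition norm_linf_mod_c0 :: "linf_mod_c0 \<Rightarrow> real" is limsup_abs
proof -
  fix x y :: "nat \<Rightarrow>\<^sub>C real" assume xy: "x - y \<in> c0"
  then have "y - x \<in> c0" by (metis minus_diff_eq subspace_c0 subspace_neg)
  with xy have "limsup_abs (x - y) = 0" "limsup_abs (y - x) = 0"
    by (simp_all add: limsup_abs_eq_0_iff)
  then show "limsup_abs x = limsup_abs y"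
    using limsup_abs_add[of "x - y" y] limsup_abs_add[of "y - x" x] by simp
qed

definition dist_linf_mod_c0 :: "linf_mod_c0 \<Rightarrow> linf_mod_c0 \<Rightarrow> real"
  where "dist_linf_mod_c0 a b = norm (a - b)"

definition sgn_linf_mod_c0 :: "linf_mod_c0 \<Rightarrow> linf_mod_c0"
  where "sgn_linf_mod_c0 a = a /\<^sub>R norm a"

definition uniformity_linf_mod_c0 :: "(linf_mod_c0 \<times> linf_mod_c0) filter"
  where "uniformity_linf_mod_c0 = (INF e\<in>{0 <..}. principal {(a, b). dist a b < e})"

definition open_linf_mod_c0 :: "linf_mod_c0 set \<Rightarrow> bool"
  where "open_linf_mod_c0 S = (\<forall>a\<in>S. \<forall>\<^sub>F (a', b) in uniformity. a' = a \<longrightarrow> b \<in> S)"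

instance
proof
  fix a b :: linf_mod_c0 and r :: real
  show "norm a = 0 \<longleftrightarrow> a = 0"
    by transfer (simp add: limsup_abs_eq_0_iff)
  show "norm (a + b) \<le> norm a + norm b"
    by transfer (rule limsup_abs_add)
  show "norm (r *\<^sub>R a) = \<bar>r\<bar> * norm a"
    by transfer (rule limsup_abs_scaleR)
qed (rule dist_linf_mod_c0_def sgn_linf_mod_c0_def uniformity_linf_mod_c0_def
       open_linf_mod_c0_def)+

end

lemma linf_proj_eq_iff: "linf_proj x = linf_proj y \<longleftrightarrow> x - y \<in> c0"
  by (rule linf_mod_c0.abs_eq_iff)

lemma norm_linf_proj:
  "ereal (norm (linf_proj x)) = limsup (\<lambda>n. ereal \<bar>apply_bcontfun x n\<bar>)"
  by (simp add: norm_linf_mod_c0.abs_eq ereal_limsup_abs)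

lemma linear_linf_proj: "linear linf_proj"
  by (rule linearI) (simp_all add: plus_linf_mod_c0.abs_eq scaleR_linf_mod_c0.abs_eq)

text \<open>
  The library's \<^const>\<open>dim\<close> assigns the value 0 to infinite-dimensional spaces, so a positive
  value of \<^const>\<open>dim\<close> entails finite dimension, but infinite dimension needs its own predicate.
\<close>

definition finite_dimensional :: "'a::real_vector set \<Rightarrow> bool" where
  "finite_dimensional V \<longleftrightarrow> (\<exists>B. finite B \<and> independent B \<and> span B = V)"


section \<open>First order logic over a relational signature\<close>

text \<open>
  A signature is a type \<^typ>\<open>'r\<close> of relation symbols with an arity function; equality is
  logical. Variables are natural numbers.
\<close>

datatype 'r fo_formula =
    Eq nat nat
  | Rel 'r "nat list"
  | Neg "'r fo_formula"
  | Conj "'r fo_formula" "'r fo_formula"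
  | Exists nat "'r fo_formula"

primrec well_formed :: "('r \<Rightarrow> nat) \<Rightarrow> 'r fo_formula \<Rightarrow> bool" where
  "well_formed ar (Eq x y) \<longleftrightarrow> True"
| "well_formed ar (Rel R xs) \<longleftrightarrow> length xs = ar R"
| "well_formed ar (Neg \<phi>) \<longleftrightarrow> well_formed ar \<phi>"
| "well_formed ar (Conj \<phi> \<psi>) \<longleftrightarrow> well_formed ar \<phi> \<and> well_formed ar \<psi>"
| "well_formed ar (Exists x \<phi>) \<longleftrightarrow> well_formed ar \<phi>"

primrec free_vars :: "'r fo_formula \<Rightarrow> nat set" where
  "free_vars (Eq x y) = {x, y}"
| "free_vars (Rel R xs) = set xs"
| "free_vars (Neg \<phi>) = free_vars \<phi>"
| "free_vars (Conj \<phi> \<psi>) = free_vars \<phi> \<union> free_vars \<psi>"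
| "free_vars (Exists x \<phi>) = free_vars \<phi> - {x}"

definition sentence :: "('r \<Rightarrow> nat) \<Rightarrow> 'r fo_formula \<Rightarrow> bool" where
  "sentence ar \<phi> \<longleftrightarrow> well_formed ar \<phi> \<and> free_vars \<phi> = {}"

datatype ('r, 'a) rel_structure =
  Structure (universe: "'a set") (interp: "'r \<Rightarrow> 'a list set")

primrec satisfies :: "('r, 'a) rel_structure \<Rightarrow> (nat \<Rightarrow> 'a) \<Rightarrow> 'r fo_formula \<Rightarrow> bool" where
  "satisfies M e (Eq x y) \<longleftrightarrow> e x = e y"
| "satisfies M e (Rel R xs) \<longleftrightarrow> map e xs \<in> interp M R"
| "satisfies M e (Neg \<phi>) \<longleftrightarrow> \<not> satisfies M e \<phi>"
| "satisfies M e (Conj \<phi> \<psi>) \<longleftrightarrow> satisfies M e \<phi> \<and> satisfies M e \<psi>"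
| "satisfies M e (Exists x \<phi>) \<longleftrightarrow> (\<exists>a\<in>universe M. satisfies M (e(x := a)) \<phi>)"

lemma satisfies_cong:
  "(\<And>x. x \<in> free_vars \<phi> \<Longrightarrow> e x = e' x) \<Longrightarrow> satisfies M e \<phi> \<longleftrightarrow> satisfies M e' \<phi>"
proof (induction \<phi> arbitrary: e e')
  case (Rel R xs)
  then have "map e xs = map e' xs" by simp
  then show ?case by (simp only: satisfies.simps)
next
  case (Conj \<phi> \<psi>)
  have "satisfies M e \<phi> \<longleftrightarrow> satisfies M e' \<phi>"
    using Conj.prems by (intro Conj.IH(1)) auto
  moreover have "satisfies M e \<psi> \<longleftrightarrow> satisfies M e' \<psi>"
    using Conj.prems by (intro Conj.IH(2)) auto
  ultimately show ?case by simp
next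
  case (Exists x \<phi>)
  have "satisfies M (e(x := a)) \<phi> \<longleftrightarrow> satisfies M (e'(x := a)) \<phi>" for a
    using Exists.prems by (intro Exists.IH) auto
  then show ?case by simp
next
  case (Neg \<phi>)
  have "satisfies M e \<phi> \<longleftrightarrow> satisfies M e' \<phi>"
    using Neg.prems by (intro Neg.IH) auto
  then show ?case by simp
qed simp

text \<open>
  The truth value of a sentence does not depend on the assignment, so quantifying over all
  assignments merely avoids choosing one (and is harmless for an empty universe).
\<close>

definition models :: "('r, 'a) rel_structure \<Rightarrow> 'r fo_formula \<Rightarrow> bool" (infix "\<Turnstile>" 50) where
  "M \<Turnstile> \<phi> \<longleftrightarrow> (\<forall>e. satisfies M e \<phi>)"

lemma models_iff_satisfies: "sentence ar \<phi> \<Longrightarrow> M \<Turnstile> \<phi> \<longleftrightarrow> satisfies M e \<phi>"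
  unfolding models_def sentence_def using satisfies_cong[of \<phi> _ e M] by auto


section \<open>First order complexity\<close>

definition prob_seq ::
    "(nat \<Rightarrow> ('r, nat) rel_structure pmf) \<Rightarrow> 'r fo_formula \<Rightarrow> (nat \<Rightarrow>\<^sub>C real)" where
  "prob_seq D \<phi> = Bcontfun (\<lambda>n. measure_pmf.prob (D n) {M. M \<Turnstile> \<phi>})"

lemma apply_prob_seq: "apply_bcontfun (prob_seq D \<phi>) n = measure_pmf.prob (D n) {M. M \<Turnstile> \<phi>}"
proof -
  have "(\<lambda>n. measure_pmf.prob (D n) {M. M \<Turnstile> \<phi>}) \<in> bcontfun"
    by (auto simp: bcontfun_def bounded_iff intro!: exI[of _ 1])
  then show ?thesis by (simp add: prob_seq_def Bcontfun_inverse)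
qed

definition FOC ::
    "('r \<Rightarrow> nat) \<Rightarrow> (nat \<Rightarrow> ('r, nat) rel_structure pmf) \<Rightarrow> linf_mod_c0 set" where
  "FOC ar D = {linf_proj (prob_seq D \<phi>) | \<phi>. sentence ar \<phi>}"


section \<open>The binomial random graph\<close>

datatype graph_symbol = Adj

primrec graph_arity :: "graph_symbol \<Rightarrow> nat" where
  "graph_arity Adj = 2"

definition possible_edges :: "nat \<Rightarrow> nat set set" where
  "possible_edges n = {e. e \<subseteq> {1..n} \<and> card e = 2}"

definition graph_structure :: "nat \<Rightarrow> nat set set \<Rightarrow> (graph_symbol, nat) rel_structure" where
  "graph_structure n E =
     Structure {1..n} (\<lambda>R. case R of Adj \<Rightarrow> {[u, v] | u v. {u, v} \<in> E})"

definition binomial_edges :: "nat \<Rightarrow> real \<Rightarrow> nat set set pmf" where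
  "binomial_edges n p =
     map_pmf (\<lambda>f. {e \<in> possible_edges n. f e})
       (Pi_pmf (possible_edges n) False (\<lambda>_. bernoulli_pmf p))"

definition binomial_random_graph :: "nat \<Rightarrow> real \<Rightarrow> (graph_symbol, nat) rel_structure pmf" where
  "binomial_random_graph n p = map_pmf (graph_structure n) (binomial_edges n p)"

abbreviation FOC_Gnp :: "(nat \<Rightarrow> real) \<Rightarrow> linf_mod_c0 set" where
  "FOC_Gnp p \<equiv> FOC graph_arity (\<lambda>n. binomial_random_graph n (p n))"

end

theory Submission
  imports Defs
begin

text \<open>
  Take \<open>p n\<close> with odds \<open>l n / (n choose 2)\<close> where \<open>(l n)\<^sup>2 / n \<longlonglongrightarrow> 0\<close>. With probability tending to
  one the random graph is a matching together with many isolated vertices, and a back-and-forth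
  argument shows that the truth of a fixed sentence in such a graph depends only on the number
  \<open>X\<close> of edges. Hence every element of the first order complexity is the class of
  \<open>P (X \<in> S)\<close> for some set \<open>S\<close>, and counting non-isolated vertices realises the sets \<open>{k..}\<close>.
  Along the indices with \<open>l n = a\<close> the variable \<open>X\<close> is asymptotically Poisson with mean \<open>a\<close>, so a
  linear relation between the classes of \<open>P (X = k)\<close>, \<open>k < m\<close>, is a polynomial of degree less
  than \<open>m\<close> that vanishes at every value taken infinitely often by \<open>l\<close>. The choice
  \<open>l n = n mod d\<close> gives dimension \<open>d\<close>. If \<open>l\<close> takes values in \<open>(0, 1]\<close>, infinitely many of
  them infinitely often, the dimension is infinite, but Markov's inequality reduces \<open>S\<close> to a
  subset of \<open>{..K}\<close> up to an error \<open>1 / (K + 1)\<close>. If \<open>l\<close> takes every natural number infinitely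
  often, no ball of radius 1/4 contains the classes of \<open>P (X \<ge> k)\<close> for infinitely many \<open>k\<close>.
\<close>

section \<open>Sentences on matchings\<close>

lemma finite_possible_edges [simp]: "finite (possible_edges n)"
  by (rule finite_subset[of _ "Pow {1..n}"]) (auto simp: possible_edges_def)

lemma card_possible_edges: "card (possible_edges n) = n choose 2"
  using n_subsets[of "{1..n}" 2] by (simp add: possible_edges_def)

section \<open>The back-and-forth game\<close>

primrec all_vars :: "'r fo_formula \<Rightarrow> nat set" where
  "all_vars (Eq x y) = {x, y}"
| "all_vars (Rel R xs) = set xs"
| "all_vars (Neg \<phi>) = all_vars \<phi>"
| "all_vars (Conj \<phi> \<psi>) = all_vars \<phi> \<union> all_vars \<psi>"
| "all_vars (Exists x \<phi>) = insert x (all_vars \<phi>)"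

lemma finite_all_vars [simp]: "finite (all_vars \<phi>)"
  by (induction \<phi>) auto

text \<open>
  The positions of the back-and-forth game: \<open>U\<close> is the universe, \<open>V\<close> the set of non-isolated
  vertices, on which the correspondence is the fixed bijection \<open>h\<close>; elsewhere only equalities and
  membership in the universe are recorded.
\<close>

definition game_position ::
    "'a set \<Rightarrow> 'a set \<Rightarrow> ('a \<Rightarrow> 'b) \<Rightarrow> 'b set \<Rightarrow> 'b set \<Rightarrow> nat set \<Rightarrow> (nat \<Rightarrow> 'a) \<Rightarrow> (nat \<Rightarrow> 'b) \<Rightarrow> bool" where
  "game_position U V h U' V' W e e' \<longleftrightarrow>
     (\<forall>y\<in>W. (e y \<in> U \<longleftrightarrow> e' y \<in> U') \<and> (e y \<in> V \<longleftrightarrow> e' y \<in> V') \<and> (e y \<in> V \<longrightarrow> e' y = h (e y))) \<and>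
     (\<forall>y\<in>W. \<forall>z\<in>W. e y = e z \<longleftrightarrow> e' y = e' z)"

text \<open>Injectivity of \<open>h\<close> on \<open>V\<close> lets the partner of a vertex be
  recovered from either side, so the two players' graphs may be swapped.\<close>

lemma game_position_sym:
  assumes "bij_betw h V V'" "game_position U V h U' V' W e e'"
  shows "game_position U' V' (the_inv_into V h) U V W e' e"
proof -
  have "the_inv_into V h (h v) = v" if "v \<in> V" for v
    using assms(1) that by (auto simp: bij_betw_def the_inv_into_f_f)
  then show ?thesis using assms(2) unfolding game_position_def by metis
qed

text \<open>A move into \<open>V\<close> must be answered by \<open>h a\<close>, and a vertex that
  another variable already names by the partner of that variable. Only a new isolated vertex leaves
  a choice, and then any unnamed element of \<open>U'\<close> outside \<open>V'\<close> will
  do.\<close>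

lemma game_position_forth:
  assumes h: "bij_betw h V V'" and pos: "game_position U V h U' V' W e e'"
    and W: "finite W" "x \<in> W" and U': "finite U'" "V' \<subseteq> U'" "card V' + card W \<le> card U'"
    and a: "a \<in> U"
  shows "\<exists>a'\<in>U'. game_position U V h U' V' W (e(x := a)) (e'(x := a'))"
proof -
  consider "a \<in> V" | y where "a \<notin> V" "y \<in> W" "y \<noteq> x" "a = e y" | "a \<notin> V" "a \<notin> e ` (W - {x})"
    by blast
  then show ?thesis
  proof cases
    case 1
    have "h a \<in> V'" using h 1 by (auto simp: bij_betw_def)
    moreover have "a = e z \<longleftrightarrow> h a = e' z" "e z = a \<longleftrightarrow> e' z = h a" if "z \<in> W" for z
      using that pos 1 h \<open>h a \<in> V'\<close> unfolding game_position_def bij_betw_def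
      by (metis inj_onD)+
    ultimately show ?thesis using 1 a pos U'(2)
      by (intro bexI[of _ "h a"]) (auto simp: game_position_def)
  next
    case (2 y)
    then show ?thesis using a pos
      by (intro bexI[of _ "e' y"]) (auto simp: game_position_def)
  next
    case 3
    have fin: "finite V'" using U' finite_subset by blast
    \<comment> \<open>The variable \<open>x\<close> is about to be reassigned and so blocks no
      vertex. This saves the one vertex by which the count becomes strict.\<close>
    have "card (V' \<union> e' ` (W - {x})) \<le> card V' + card (W - {x})"
      by (meson W(1) add_le_mono card_Un_le card_image_le dual_order.trans finite_Diff le_refl)
    also have "\<dots> < card V' + card W"
      using card_Diff1_less[OF W] by simp
    finally have "\<not> U' \<subseteq> V' \<union> e' ` (W - {x})"
      using U' fin W card_mono[of "V' \<union> e' ` (W - {x})" U'] by auto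
    then obtain a' where a': "a' \<in> U'" "a' \<notin> V'" "a' \<notin> e' ` (W - {x})" by blast
    then show ?thesis using 3 a pos
      by (intro bexI[of _ a']) (auto simp: game_position_def)
  qed
qed

text \<open>The forth move, played on the swapped position with the inverse bijection.\<close>

lemma game_position_back:
  assumes h: "bij_betw h V V'" and pos: "game_position U V h U' V' W e e'"
    and W: "finite W" "x \<in> W" and U: "finite U" "V \<subseteq> U" "card V + card W \<le> card U"
    and a: "a' \<in> U'"
  shows "\<exists>a\<in>U. game_position U V h U' V' W (e(x := a)) (e'(x := a'))"
proof -
  let ?g = "the_inv_into V h"
  have g: "bij_betw ?g V' V" using h by (rule bij_betw_the_inv_into)
  obtain a where a: "a \<in> U" "game_position U' V' ?g U V W (e'(x := a')) (e(x := a))"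
    using game_position_forth[OF g game_position_sym[OF h pos] W U a] by blast
  \<comment> \<open>A position evaluates the bijection on \<open>V\<close> only, so agreement there
    is enough to replace the double inverse by \<open>h\<close>.\<close>
  have "the_inv_into V' ?g v = h v" if "v \<in> V" for v
    using h that by (intro the_inv_into_f_eq)
      (auto simp: bij_betw_def inj_on_the_inv_into the_inv_into_f_f)
  then have "game_position U V h U' V' W (e(x := a)) (e'(x := a'))"
    using game_position_sym[OF g a(2)] unfolding game_position_def by metis
  with a(1) show ?thesis by blast
qed

text \<open>Edges join non-isolated vertices only, where \<open>h\<close> is an isomorphism, so a
  position decides all atomic formulas; quantifiers are the forth and back moves. Since
  \<open>W\<close> contains the bound variables too, it stays fixed in the induction, and one bound
  on the size of the graphs leaves room for every move.\<close>

lemma satisfies_iff_game_position: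
  assumes E: "E \<subseteq> possible_edges n" and E': "E' \<subseteq> possible_edges n'"
    and h: "bij_betw h (\<Union>E) (\<Union>E')"
    and edge: "\<And>u v. u \<in> \<Union>E \<Longrightarrow> v \<in> \<Union>E \<Longrightarrow> {u, v} \<in> E \<longleftrightarrow> {h u, h v} \<in> E'"
    and W: "finite W" "card (\<Union>E) + card W \<le> n" "card (\<Union>E') + card W \<le> n'"
    and "all_vars \<phi> \<subseteq> W" "well_formed graph_arity \<phi>"
    and "game_position {1..n} (\<Union>E) h {1..n'} (\<Union>E') W e e'"
  shows "satisfies (graph_structure n E) e \<phi> \<longleftrightarrow> satisfies (graph_structure n' E') e' \<phi>"
  using assms(8-)
proof (induction \<phi> arbitrary: e e')
  case (Eq x y)
  then have "x \<in> W" "y \<in> W" by auto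
  then show ?case using Eq.prems(3) unfolding game_position_def satisfies.simps by blast
next
  case (Rel R xs)
  obtain x y where xs: "xs = [x, y]" and R: "R = Adj"
    using Rel.prems(2) by (cases R) (auto simp: length_Suc_conv numeral_2_eq_2)
  have xy: "x \<in> W" "y \<in> W" using Rel.prems(1) xs by auto
  have "{e x, e y} \<in> E \<longleftrightarrow> {e' x, e' y} \<in> E'"
  proof (cases "e x \<in> \<Union>E \<and> e y \<in> \<Union>E")
    case True
    then have "e' x = h (e x)" "e' y = h (e y)"
      using Rel.prems(3) xy unfolding game_position_def by blast+
    then show ?thesis using edge True by simp
  next
    case False
    then have "\<not> (e' x \<in> \<Union>E' \<and> e' y \<in> \<Union>E')"
      using Rel.prems(3) xy unfolding game_position_def by blast
    with False show ?thesis by auto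
  qed
  then show ?case by (simp add: graph_structure_def R xs)
next
  case (Neg \<phi>)
  then show ?case by auto
next
  case (Conj \<phi> \<psi>)
  then show ?case by auto
next
  case (Exists x \<phi>)
  have sub: "\<Union>E \<subseteq> {1..n}" "\<Union>E' \<subseteq> {1..n'}"
    using E E' by (auto simp: possible_edges_def)
  have x: "x \<in> W" using Exists.prems(1) by simp
  have IH: "satisfies (graph_structure n E) (e(x := a)) \<phi> \<longleftrightarrow>
      satisfies (graph_structure n' E') (e'(x := a')) \<phi>"
    if "game_position {1..n} (\<Union>E) h {1..n'} (\<Union>E') W (e(x := a)) (e'(x := a'))" for a a'
    using Exists.prems by (intro Exists.IH[OF _ _ that]) auto
  show ?case
  proof
    assume "satisfies (graph_structure n E) e (Exists x \<phi>)"
    then obtain a where a: "a \<in> {1..n}" "satisfies (graph_structure n E) (e(x := a)) \<phi>"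
      by (auto simp: graph_structure_def)
    obtain a' where a': "a' \<in> {1..n'}"
        "game_position {1..n} (\<Union>E) h {1..n'} (\<Union>E') W (e(x := a)) (e'(x := a'))"
      using game_position_forth[OF h Exists.prems(3) W(1) x _ sub(2) _ a(1)] W(3) by auto
    have "satisfies (graph_structure n' E') (e'(x := a')) \<phi>"
      using IH[OF a'(2)] a(2) by blast
    with a'(1) show "satisfies (graph_structure n' E') e' (Exists x \<phi>)"
      by (auto simp: graph_structure_def)
  next
    assume "satisfies (graph_structure n' E') e' (Exists x \<phi>)"
    then obtain a' where a': "a' \<in> {1..n'}" "satisfies (graph_structure n' E') (e'(x := a')) \<phi>"
      by (auto simp: graph_structure_def)
    obtain a where a: "a \<in> {1..n}"
        "game_position {1..n} (\<Union>E) h {1..n'} (\<Union>E') W (e(x := a)) (e'(x := a'))"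
      using game_position_back[OF h Exists.prems(3) W(1) x _ sub(1) _ a'(1)] W(2) by auto
    have "satisfies (graph_structure n E) (e(x := a)) \<phi>"
      using IH[OF a(2)] a'(2) by blast
    with a(1) show "satisfies (graph_structure n E) e (Exists x \<phi>)"
      by (auto simp: graph_structure_def)
  qed
qed

section \<open>Matchings with equally many edges\<close>

lemma card_Union_matching:
  assumes "finite E" "disjoint E" "\<And>e. e \<in> E \<Longrightarrow> card e = 2"
  shows "card (\<Union>E) = 2 * card E"
proof -
  have "card (\<Union>E) = sum card E"
    using assms by (intro card_Union_disjoint) (auto simp: pairwise_def disjnt_def intro: card_ge_0_finite)
  then show ?thesis using assms by simp
qed

text \<open>Any bijection \<open>g\<close> of the edges, refined by a bijection from each edge
  \<open>e\<close> onto \<open>g e\<close>, glues to a bijection of the vertices because the edges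
  are disjoint.\<close>

lemma matching_isomorphism:
  fixes E :: "'a set set" and E' :: "'b set set"
  assumes E: "finite E" "disjoint E" "\<And>e. e \<in> E \<Longrightarrow> card e = 2"
    and E': "finite E'" "disjoint E'" "\<And>e. e \<in> E' \<Longrightarrow> card e = 2"
    and "card E = card E'"
  obtains h where "bij_betw h (\<Union>E) (\<Union>E')"
    "\<And>u v. u \<in> \<Union>E \<Longrightarrow> v \<in> \<Union>E \<Longrightarrow> {u, v} \<in> E \<longleftrightarrow> {h u, h v} \<in> E'"
proof -
  obtain g where g: "bij_betw g E E'"
    using finite_same_card_bij E(1) E'(1) assms(7) by blast
  have gE: "g e \<in> E'" if "e \<in> E" for e using g that by (auto simp: bij_betw_def)
  have "\<exists>f. bij_betw f e (g e)" if "e \<in> E" for e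
    using that E(3) E'(3) gE by (intro finite_same_card_bij) (auto intro: card_ge_0_finite)
  then obtain f where f: "\<And>e. e \<in> E \<Longrightarrow> bij_betw (f e) e (g e)" by metis
  \<comment> \<open>In a matching the edge through a non-isolated vertex is unique, so the
    description denotes it.\<close>
  define h where "h = (\<lambda>v. f (THE e. e \<in> E \<and> v \<in> e) v)"
  have the: "(THE e. e \<in> E \<and> v \<in> e) = e" if "e \<in> E" "v \<in> e" for e v
    using that E(2) by (intro the_equality) (auto simp: pairwise_def disjnt_def)
  have hbij: "bij_betw h e (g e)" if "e \<in> E" for e
  proof -
    have "h v = f e v" if "v \<in> e" for v
      using the[OF \<open>e \<in> E\<close> that] by (simp add: h_def)
    then show ?thesis using f[OF that] bij_betw_cong by metis
  qed
  have "disjoint_family_on g E"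
    unfolding disjoint_family_on_def
  proof (intro ballI impI)
    fix a b assume "a \<in> E" "b \<in> E" "a \<noteq> b"
    moreover from this have "g a \<noteq> g b" using g by (auto simp: bij_betw_def inj_on_def)
    ultimately show "g a \<inter> g b = {}"
      using gE E'(2) by (auto simp: pairwise_def disjnt_def)
  qed
  then have "bij_betw h (\<Union>e\<in>E. e) (\<Union>e\<in>E. g e)"
    using hbij by (rule bij_betw_UNION_disjoint)
  then have bij: "bij_betw h (\<Union>E) (\<Union>E')" using g by (simp add: bij_betw_def)
  have "{u, v} \<in> E \<longleftrightarrow> {h u, h v} \<in> E'" if uv: "u \<in> \<Union>E" "v \<in> \<Union>E" for u v
  proof
    assume "{u, v} \<in> E"
    then show "{h u, h v} \<in> E'" using hbij[of "{u, v}"] gE[of "{u, v}"] by (simp add: bij_betw_def)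
  next
    assume A: "{h u, h v} \<in> E'"
    obtain e1 e2 where e: "e1 \<in> E" "u \<in> e1" "e2 \<in> E" "v \<in> e2" using uv by auto
    have "h u \<in> g e1" "h v \<in> g e2" using hbij e by (auto simp: bij_betw_def)
    \<comment> \<open>Any one vertex determines its edge in \<open>E'\<close>; hence
      \<open>e1\<close> and \<open>e2\<close> have the same image under \<open>g\<close>.\<close>
    moreover have "s = t" if "s \<in> E'" "t \<in> E'" "z \<in> s" "z \<in> t" for s t z
      using that E'(2) by (auto simp: pairwise_def disjnt_def)
    ultimately have "g e1 = {h u, h v}" "g e2 = {h u, h v}"
      using gE e A by (meson insertCI)+
    then have "e1 = e2" using g e by (auto simp: bij_betw_def inj_on_def)
    moreover have "u \<noteq> v" using E'(3)[OF A] by auto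
    moreover have "card e1 = 2" using E e by auto
    ultimately have "e1 = {u, v}" using e by (auto simp: card_2_iff)
    then show "{u, v} \<in> E" using e by simp
  qed
  with bij that show ?thesis by blast
qed

text \<open>The vertex numbers \<open>n\<close> and \<open>n'\<close> may differ: beyond the
  \<open>2 * card E\<close> matched vertices it only matters that one isolated vertex is available
  per variable.\<close>

lemma matchings_models_iff:
  assumes "sentence graph_arity \<phi>"
    and E: "E \<subseteq> possible_edges n" "disjoint E" "2 * card E + card (all_vars \<phi>) \<le> n"
    and E': "E' \<subseteq> possible_edges n'" "disjoint E'" "2 * card E' + card (all_vars \<phi>) \<le> n'"
    and "card E = card E'"
  shows "graph_structure n E \<Turnstile> \<phi> \<longleftrightarrow> graph_structure n' E' \<Turnstile> \<phi>"
proof -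
  have fin: "finite E" "finite E'"
    using E(1) E'(1) finite_subset[OF _ finite_possible_edges] by auto
  have two: "\<And>e. e \<in> E \<Longrightarrow> card e = 2" "\<And>e. e \<in> E' \<Longrightarrow> card e = 2"
    using E(1) E'(1) by (auto simp: possible_edges_def)
  obtain h where h: "bij_betw h (\<Union>E) (\<Union>E')"
    "\<And>u v. u \<in> \<Union>E \<Longrightarrow> v \<in> \<Union>E \<Longrightarrow> {u, v} \<in> E \<longleftrightarrow> {h u, h v} \<in> E'"
    using matching_isomorphism[OF fin(1) E(2) two(1) fin(2) E'(2) two(2) assms(8)] by blast
  have "\<Union>E \<subseteq> {1..n}" "\<Union>E' \<subseteq> {1..n'}"
    using E(1) E'(1) by (auto simp: possible_edges_def)
  \<comment> \<open>The constant assignment \<open>0\<close> lies outside both universes, so it is a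
    legal starting position without any vertex being named.\<close>
  then have zero: "0 \<notin> \<Union>E" "0 \<notin> \<Union>E'" by auto
  have "satisfies (graph_structure n E) (\<lambda>_. 0) \<phi> \<longleftrightarrow> satisfies (graph_structure n' E') (\<lambda>_. 0) \<phi>"
    using assms(1) E(3) E'(3) zero
    by (intro satisfies_iff_game_position[OF E(1) E'(1) h, of "all_vars \<phi>"])
      (simp_all add: card_Union_matching[OF fin(1) E(2) two(1)]
         card_Union_matching[OF fin(2) E'(2) two(2)] sentence_def game_position_def)
  then show ?thesis using models_iff_satisfies[OF assms(1)] by metis
qed

section \<open>Sentences that count non-isolated vertices\<close>

definition verum :: "'r fo_formula" where
  "verum = Neg (Exists 0 (Neg (Eq 0 0)))"

primrec distinct_from_below :: "nat \<Rightarrow> nat \<Rightarrow> graph_symbol fo_formula" where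
  "distinct_from_below k 0 = verum"
| "distinct_from_below k (Suc i) = Conj (Neg (Eq i k)) (distinct_from_below k i)"

text \<open>The variables below \<open>k\<close> hold the vertices chosen so far. Variable
  \<open>Suc k\<close> first names a neighbour of the new vertex \<open>k\<close> and is then reused
  for the next choice.\<close>

primrec many_nonisolated :: "nat \<Rightarrow> nat \<Rightarrow> graph_symbol fo_formula" where
  "many_nonisolated 0 k = verum"
| "many_nonisolated (Suc m) k =
     Exists k (Conj (distinct_from_below k k)
       (Conj (Exists (Suc k) (Rel Adj [k, Suc k])) (many_nonisolated m (Suc k))))"

lemma satisfies_verum [simp]: "satisfies M e verum"
  by (simp add: verum_def)

lemma satisfies_distinct_from_below: "satisfies M e (distinct_from_below k i) \<longleftrightarrow> e k \<notin> e ` {..<i}"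
  by (induction i) (auto simp: lessThan_Suc)

text \<open>Induction on \<open>m\<close> with \<open>k\<close> and \<open>e\<close> arbitrary: each
  chosen vertex is removed from the set that remains to be counted.\<close>

lemma satisfies_many_nonisolated:
  assumes E: "E \<subseteq> possible_edges n"
  shows "satisfies (graph_structure n E) e (many_nonisolated m k) \<longleftrightarrow> m \<le> card (\<Union>E - e ` {..<k})"
proof (induction m arbitrary: k e)
  case (Suc m)
  have sub: "\<Union>E \<subseteq> {1..n}" using E by (auto simp: possible_edges_def)
  then have fin: "finite (\<Union>E)" by (rule finite_subset) simp
  have noniso: "(\<exists>b\<in>{1..n}. {a, b} \<in> E) \<longleftrightarrow> a \<in> \<Union>E" for a
  proof
    assume "a \<in> \<Union>E"
    then obtain s where "s \<in> E" "a \<in> s" by blast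
    moreover then obtain b where "s = {a, b}"
      using E by (auto simp: possible_edges_def card_2_iff)
    ultimately show "\<exists>b\<in>{1..n}. {a, b} \<in> E" using sub by blast
  qed auto
  have img: "(e(k := a)) ` {..<Suc k} = insert a (e ` {..<k})" for a
    by (auto simp: lessThan_Suc)
  have img': "(e(k := a)) ` {..<k} = e ` {..<k}" for a by auto
  have sat: "satisfies (graph_structure n E) (e(k := a)) (Exists (Suc k) (Rel Adj [k, Suc k])) \<longleftrightarrow> a \<in> \<Union>E"
    for a using noniso[of a] by (auto simp: graph_structure_def)
  have "satisfies (graph_structure n E) e (many_nonisolated (Suc m) k) \<longleftrightarrow>
      (\<exists>a\<in>{1..n}. a \<notin> e ` {..<k} \<and> a \<in> \<Union>E \<and> m \<le> card (\<Union>E - insert a (e ` {..<k})))"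
    unfolding many_nonisolated.simps satisfies.simps(5)[of _ _ k] satisfies.simps(4)
      satisfies_distinct_from_below sat Suc.IH img img'
    by (simp add: graph_structure_def)
  also have "\<dots> \<longleftrightarrow> (\<exists>a\<in>\<Union>E - e ` {..<k}. m \<le> card (\<Union>E - insert a (e ` {..<k})))"
    using sub by blast
  also have "\<dots> \<longleftrightarrow> (\<exists>a\<in>\<Union>E - e ` {..<k}. Suc m \<le> card (\<Union>E - e ` {..<k}))"
  proof (rule bex_cong[OF refl])
    fix a assume a: "a \<in> \<Union>E - e ` {..<k}"
    have "\<Union>E - insert a (e ` {..<k}) = (\<Union>E - e ` {..<k}) - {a}" by blast
    then show "m \<le> card (\<Union>E - insert a (e ` {..<k})) \<longleftrightarrow> Suc m \<le> card (\<Union>E - e ` {..<k})"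
      using card_Suc_Diff1[OF _ a] fin Suc_le_mono by (metis finite_Diff)
  qed
  \<comment> \<open>The bound no longer mentions \<open>a\<close>, and a set with at least
    \<open>Suc m\<close> elements supplies one.\<close>
  also have "\<dots> \<longleftrightarrow> Suc m \<le> card (\<Union>E - e ` {..<k})"
    by (metis card.empty ex_in_conv not_less_eq_eq le0)
  finally show ?case .
qed simp

lemma sentence_many_nonisolated: "sentence graph_arity (many_nonisolated m 0)"
proof -
  have "free_vars (distinct_from_below k i) \<subseteq> insert k {..<i}" for k i
    by (induction i) (auto simp: verum_def)
  then have "free_vars (many_nonisolated m k) \<subseteq> {..<k}" for k
    by (induction m arbitrary: k) (fastforce simp: verum_def)+
  moreover have "well_formed graph_arity (distinct_from_below k i)" for k i
    by (induction i) (auto simp: verum_def)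
  then have "well_formed graph_arity (many_nonisolated m k)" for k
    by (induction m arbitrary: k) (auto simp: verum_def)
  ultimately show ?thesis by (auto simp: sentence_def)
qed

text \<open>In a matching each edge accounts for exactly two non-isolated vertices, hence the factor
  \<open>2\<close>.\<close>

lemma matching_models_many_nonisolated:
  assumes E: "E \<subseteq> possible_edges n" "disjoint E"
  shows "graph_structure n E \<Turnstile> many_nonisolated (2 * k) 0 \<longleftrightarrow> k \<le> card E"
proof -
  have "card (\<Union>E) = 2 * card E"
    using E finite_subset[OF E(1)] by (intro card_Union_matching) (auto simp: possible_edges_def)
  then show ?thesis
    by (simp add: models_iff_satisfies[OF sentence_many_nonisolated, of _ _ "\<lambda>_. 0"]
        satisfies_many_nonisolated[OF E(1)])
qed

section \<open>The number of edges\<close>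

lemma set_pmf_binomial_edges: "set_pmf (binomial_edges n p) \<subseteq> Pow (possible_edges n)"
  by (auto simp: binomial_edges_def)

lemma map_card_binomial_edges:
  assumes "p \<in> {0..1}"
  shows "map_pmf card (binomial_edges n p) = binomial_pmf (n choose 2) p"
  unfolding binomial_edges_def map_pmf_comp
  by (rule binomial_pmf_altdef'[OF _ card_possible_edges assms, symmetric]) simp

text \<open>Independence: the event is a box in the product measure, and every unconstrained factor
  contributes \<open>1\<close>.\<close>

lemma prob_two_edges:
  assumes p: "p \<in> {0..1}" and ab: "a \<in> possible_edges n" "b \<in> possible_edges n" "a \<noteq> b"
  shows "measure_pmf.prob (binomial_edges n p) {E. a \<in> E \<and> b \<in> E} = p\<^sup>2"
proof -
  let ?B = "\<lambda>x. if x \<in> {a, b} then {True} else UNIV"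
  have "measure_pmf.prob (binomial_edges n p) {E. a \<in> E \<and> b \<in> E} =
      measure_pmf.prob (Pi_pmf (possible_edges n) False (\<lambda>_. bernoulli_pmf p)) (Pi (possible_edges n) ?B)"
    unfolding binomial_edges_def measure_map_pmf
    by (rule arg_cong[where f = "measure_pmf.prob _"]) (use ab in \<open>force simp: Pi_iff\<close>)
  also have "\<dots> = (\<Prod>x\<in>possible_edges n. measure_pmf.prob (bernoulli_pmf p) (?B x))"
    by (rule measure_Pi_pmf_Pi) simp
  also have "\<dots> = (\<Prod>x\<in>{a, b}. measure_pmf.prob (bernoulli_pmf p) (?B x))"
    by (rule prod.mono_neutral_right) (use ab in auto)
  also have "\<dots> = p\<^sup>2"
    using ab p by (simp add: measure_pmf_single power2_eq_square)
  finally show ?thesis .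
qed

text \<open>Union bound over the paths with two edges: a triple \<open>(a, b, c)\<close> in
  \<open>T\<close> consists of the common vertex \<open>a\<close> and the other ends
  \<open>b\<close>, \<open>c\<close> of two distinct edges.\<close>

lemma prob_not_matching:
  assumes p: "p \<in> {0..1}"
  shows "measure_pmf.prob (binomial_edges n p) {E. \<not> disjoint E} \<le> real n ^ 3 * p\<^sup>2"
proof -
  let ?P = "measure_pmf.prob (binomial_edges n p)"
  define T where "T = {(a, b, c) \<in> {1..n} \<times> {1..n} \<times> {1..n}.
    {a, b} \<in> possible_edges n \<and> {a, c} \<in> possible_edges n \<and> {a, b} \<noteq> {a, c}}"
  let ?F = "\<lambda>(a, b, c). {E. {a, b} \<in> E \<and> {a, c} \<in> E}"
  have T: "finite T" "card T \<le> n ^ 3"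
  proof -
    have "T \<subseteq> {1..n} \<times> {1..n} \<times> {1..n}" by (auto simp: T_def)
    then show "finite T" "card T \<le> n ^ 3"
      using finite_subset[of T] card_mono[of "{1..n} \<times> {1..n} \<times> {1..n}" T]
      by (auto simp: card_cartesian_product power3_eq_cube)
  qed
  have sub: "{E. \<not> disjoint E} \<inter> set_pmf (binomial_edges n p) \<subseteq> (\<Union>t\<in>T. ?F t)"
  proof
    fix E assume "E \<in> {E. \<not> disjoint E} \<inter> set_pmf (binomial_edges n p)"
    then have E: "\<not> disjoint E" "E \<subseteq> possible_edges n" using set_pmf_binomial_edges by auto
    then obtain s t a where st: "s \<in> E" "t \<in> E" "s \<noteq> t" "a \<in> s" "a \<in> t"
      by (auto simp: pairwise_def disjnt_def)
    have "\<exists>b. e = {a, b}" if "e \<in> E" "a \<in> e" for e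
      using that E(2) by (auto simp: possible_edges_def card_2_iff)
    then obtain b c where "s = {a, b}" "t = {a, c}" using st by metis
    moreover have "{a, b, c} \<subseteq> {1..n}"
      using E(2) st calculation by (auto simp: possible_edges_def)
    ultimately have "(a, b, c) \<in> T" "E \<in> ?F (a, b, c)" using st E(2) by (auto simp: T_def)
    then show "E \<in> (\<Union>t\<in>T. ?F t)" by blast
  qed
  have "?P {E. \<not> disjoint E} = ?P ({E. \<not> disjoint E} \<inter> set_pmf (binomial_edges n p))"
    by (simp add: measure_Int_set_pmf)
  also have "\<dots> \<le> ?P (\<Union>t\<in>T. ?F t)"
    using sub by (intro measure_pmf.finite_measure_mono) auto
  also have "\<dots> \<le> (\<Sum>t\<in>T. ?P (?F t))"
    using T by (intro measure_pmf.finite_measure_subadditive_finite) auto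
  also have "\<dots> = (\<Sum>t\<in>T. p\<^sup>2)"
  proof (rule sum.cong[OF refl])
    fix t assume "t \<in> T"
    then obtain a b c where t: "t = (a, b, c)" "{a, b} \<in> possible_edges n"
        "{a, c} \<in> possible_edges n" "{a, b} \<noteq> {a, c}"
      unfolding T_def by blast
    show "?P (?F t) = p\<^sup>2"
      unfolding t(1) prod.case by (rule prob_two_edges[OF p t(2-4)])
  qed
  also have "\<dots> = real (card T) * p\<^sup>2" by simp
  also have "\<dots> \<le> real n ^ 3 * p\<^sup>2"
    using T(2) by (intro mult_right_mono) (simp_all flip: of_nat_power)
  finally show ?thesis .
qed

lemma binomial_Markov:
  assumes p: "p \<in> {0..1}" and c: "c > 0"
  shows "measure_pmf.prob (binomial_pmf N p) {k. c \<le> real k} \<le> real N * p / c"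
proof -
  have "measure_pmf.prob (binomial_pmf N p) {k \<in> space (measure_pmf (binomial_pmf N p)). c \<le> real k}
      \<le> measure_pmf.expectation (binomial_pmf N p) real / c"
    using p c by (intro integral_Markov_inequality_measure[where A = UNIV]) auto
  \<comment> \<open>The mean comes from the first moment identity of the Bernstein
    polynomials.\<close>
  also have "measure_pmf.expectation (binomial_pmf N p) real = (\<Sum>k\<le>N. real k * Bernstein N k p)"
    using p by (simp add: expectation_binomial_pmf' Bernstein_def mult_ac)
  finally show ?thesis by simp
qed

text \<open>
  Prescribing the odds \<open>l / N\<close>, \<open>N = n choose 2\<close>, makes \<open>P (X = k) / P (X = 0)\<close> equal to
  \<open>(N choose k) * (l / N) ^ k\<close>.
\<close>

definition edge_prob :: "real \<Rightarrow> nat \<Rightarrow> real" where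
  "edge_prob l n = l / (real (n choose 2) + l)"

lemma edge_prob_bounds: "l \<ge> 0 \<Longrightarrow> edge_prob l n \<in> {0..1}"
  by (auto simp: edge_prob_def divide_le_eq_1)

abbreviation edge_count :: "real \<Rightarrow> nat \<Rightarrow> nat pmf" where
  "edge_count l n \<equiv> binomial_pmf (n choose 2) (edge_prob l n)"

text \<open>With \<open>N = n choose 2\<close> the mean is \<open>N * l / (N + l)\<close>, which is
  at most \<open>l\<close> for every \<open>n\<close>; the tail bound is therefore uniform in
  \<open>n\<close>.\<close>

lemma edge_count_Markov:
  assumes l: "l \<ge> 0" and c: "c > 0"
  shows "measure_pmf.prob (edge_count l n) {k. c \<le> real k} \<le> l / c"
proof -
  have "real (n choose 2) * edge_prob l n \<le> l"
  proof (cases "real (n choose 2) + l = 0")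
    case False
    then have "real (n choose 2) + l > 0" using l by (simp add: add_nonneg_eq_0_iff less_le)
    then show ?thesis using l by (simp add: edge_prob_def field_simps)
  qed (use l in \<open>simp add: edge_prob_def\<close>)
  then have "real (n choose 2) * edge_prob l n / c \<le> l / c" using c by (simp add: divide_right_mono)
  then show ?thesis using binomial_Markov[OF edge_prob_bounds[OF l] c] by (rule order_trans[rotated])
qed

lemma choose_two_ge: "n \<ge> 2 \<Longrightarrow> real n ^ 2 / 4 \<le> real (n choose 2)"
proof -
  assume n: "n \<ge> 2"
  have "even (n * (n - 1))" by auto
  then have "real (n choose 2) = real n * (real n - 1) / 2"
    using n by (simp add: choose_two real_of_nat_div of_nat_diff)
  moreover have "real n * 2 \<le> real n * real n" using n by (intro mult_left_mono) auto
  ultimately show ?thesis by (simp add: field_simps power2_eq_square)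
qed

section \<open>The Poisson limit of the edge count\<close>

lemma filterlim_choose_two: "filterlim (\<lambda>n. n choose 2) at_top sequentially"
proof (rule filterlim_at_top_mono)
  show "filterlim (\<lambda>n::nat. n - 1) at_top sequentially"
    by (rule filterlim_minus_const_nat_at_top)
  show "\<forall>\<^sub>F n in sequentially. n - 1 \<le> n choose 2"
  proof (rule eventually_sequentiallyI[of 2])
    fix n :: nat assume "n \<ge> 2"
    then have "2 * (n - 1) \<le> n * (n - 1)" by (rule mult_right_mono) simp
    then have "2 * (n - 1) div 2 \<le> n * (n - 1) div 2" by (rule div_le_mono)
    then show "n - 1 \<le> n choose 2" by (simp add: choose_two)
  qed
qed

text \<open>The coefficient is the product of the \<open>k\<close> factors \<open>N - i\<close> over
  \<open>fact k\<close>, and each factor divided by \<open>N\<close> tends to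
  \<open>1\<close>.\<close>

lemma binomial_div_power_tendsto: "(\<lambda>N. real (N choose k) / real N ^ k) \<longlonglongrightarrow> 1 / fact k"
proof -
  have "(\<lambda>N. real N / real N) \<longlonglongrightarrow> 1"
    by (rule tendsto_eventually) (auto intro: eventually_sequentiallyI[of 1])
  then have "(\<lambda>N. real N / real N - real i / real N) \<longlonglongrightarrow> 1 - 0" for i
    by (intro tendsto_diff lim_const_over_n)
  then have "(\<lambda>N. (\<Prod>i<k. real N / real N - real i / real N) / fact k) \<longlonglongrightarrow> (\<Prod>i<k. 1 - 0) / fact k"
    by (intro tendsto_divide tendsto_prod tendsto_const) auto
  moreover have "real (N choose k) / real N ^ k = (\<Prod>i<k. real N / real N - real i / real N) / fact k" for N
    unfolding diff_divide_distrib[symmetric] prod_dividef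
    by (simp add: binomial_gbinomial gbinomial_prod_rev atLeast0LessThan)
  ultimately show ?thesis by simp
qed

lemma edge_count_tendsto_Poisson:
  assumes l: "l \<ge> 0"
  shows "(\<lambda>n. pmf (edge_count l n) k) \<longlonglongrightarrow> exp (- l) * l ^ k / fact k"
proof -
  have "(\<lambda>N. real (N choose k) / real N ^ k * l ^ k / (1 + l / real N) ^ N) \<longlonglongrightarrow> 1 / fact k * l ^ k / exp l"
    by (intro tendsto_intros binomial_div_power_tendsto tendsto_exp_limit_sequentially) simp
  then have "(\<lambda>n. real ((n choose 2) choose k) / real (n choose 2) ^ k * l ^ k / (1 + l / real (n choose 2)) ^ (n choose 2))
      \<longlonglongrightarrow> 1 / fact k * l ^ k / exp l"
    by (rule filterlim_compose[OF _ filterlim_choose_two])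
  moreover have "\<forall>\<^sub>F n in sequentially. real ((n choose 2) choose k) / real (n choose 2) ^ k * l ^ k / (1 + l / real (n choose 2)) ^ (n choose 2)
      = pmf (edge_count l n) k"
  proof -
    \<comment> \<open>This bound gives both \<open>k \<le> N\<close> and
      \<open>N > 0\<close>.\<close>
    have "\<forall>\<^sub>F n in sequentially. n choose 2 \<ge> Suc k"
      using filterlim_choose_two by (simp add: filterlim_at_top)
    then show ?thesis
    proof eventually_elim
      case (elim n)
      define N where "N = n choose 2"
      define q where "q = edge_prob l n"
      have N: "real N > 0" "k \<le> N" using elim unfolding N_def by linarith+
      have pos: "real N + l > 0" using N l by simp
      have q: "1 - q = 1 / (1 + l / real N)" "q = l / real N * (1 - q)"
        using N pos by (simp_all add: q_def edge_prob_def field_simps flip: N_def)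
      \<comment> \<open>Writing \<open>q\<close> as odds times \<open>1 - q\<close> merges the
        powers of \<open>1 - q\<close> into the single exponent \<open>N\<close>, whose limit is the
        exponential.\<close>
      have "q ^ k * (1 - q) ^ (N - k) = (l / real N) ^ k * ((1 - q) ^ k * (1 - q) ^ (N - k))"
        by (subst q(2)) (simp only: power_mult_distrib mult.assoc)
      also have "\<dots> = (l / real N) ^ k * (1 - q) ^ N"
        using N(2) by (simp flip: power_add)
      also have "\<dots> = l ^ k / real N ^ k / (1 + l / real N) ^ N"
        unfolding q(1) by (simp add: power_divide)
      finally have *: "q ^ k * (1 - q) ^ (N - k) = l ^ k / real N ^ k / (1 + l / real N) ^ N" .
      have "pmf (edge_count l n) k = real (N choose k) * (q ^ k * (1 - q) ^ (N - k))"
        using edge_prob_bounds[OF l, of n] by (simp add: N_def q_def)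
      then show ?case unfolding * by (simp add: N_def)
    qed
  qed
  ultimately have "(\<lambda>n. pmf (edge_count l n) k) \<longlonglongrightarrow> 1 / fact k * l ^ k / exp l"
    by (rule Lim_transform_eventually)
  then show ?thesis by (simp add: exp_minus field_simps)
qed

section \<open>From random graphs to edge counts\<close>

lemma prob_models_binomial_random_graph:
  "measure_pmf.prob (binomial_random_graph n p) {M. M \<Turnstile> \<phi>} =
     measure_pmf.prob (binomial_edges n p) {E. graph_structure n E \<Turnstile> \<phi>}"
  by (simp add: binomial_random_graph_def vimage_def)

text \<open>The two events agree off \<open>bad\<close>, where the graph is not a matching or has at
  least \<open>n / 4\<close> edges. The union bound and Markov's inequality show that
  \<open>bad\<close> has vanishing probability.\<close>

lemma prob_models_edge_count:
  assumes l: "\<And>n. l n \<ge> 0" "(\<lambda>n. (l n)\<^sup>2 / real n) \<longlonglongrightarrow> 0"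
    and S: "\<And>n E. E \<subseteq> possible_edges n \<Longrightarrow> disjoint E \<Longrightarrow> 2 * card E + w \<le> n \<Longrightarrow>
      graph_structure n E \<Turnstile> \<phi> \<longleftrightarrow> card E \<in> S"
  shows "(\<lambda>n. measure_pmf.prob (binomial_random_graph n (edge_prob (l n) n)) {M. M \<Turnstile> \<phi>} -
    measure_pmf.prob (edge_count (l n) n) S) \<longlonglongrightarrow> 0"
proof (rule Lim_null_comparison)
  show "(\<lambda>n. 20 * ((l n)\<^sup>2 / real n) + 4 * (1 / real n)) \<longlonglongrightarrow> 0"
    using tendsto_add[OF tendsto_mult_right_zero[OF l(2), of 20] tendsto_mult_right_zero[OF lim_1_over_n, of 4]]
    by simp
  show "\<forall>\<^sub>F n in sequentially. norm (measure_pmf.prob (binomial_random_graph n (edge_prob (l n) n)) {M. M \<Turnstile> \<phi>} -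
    measure_pmf.prob (edge_count (l n) n) S) \<le> 20 * ((l n)\<^sup>2 / real n) + 4 * (1 / real n)"
  \<comment> \<open>From here on, fewer than \<open>n / 4\<close> edges leave room for
    \<open>w\<close> further vertices, and \<open>n \<ge> 2\<close> makes \<open>n choose 2\<close>
    positive.\<close>
  proof (rule eventually_sequentiallyI[of "2 * w + 2"])
    fix n assume n: "2 * w + 2 \<le> n"
    define p where "p = edge_prob (l n) n"
    define Q where "Q = binomial_edges n p"
    have p: "p \<in> {0..1}" using edge_prob_bounds[OF l(1)] by (simp add: p_def)
    define A where "A = {E. graph_structure n E \<Turnstile> \<phi>}"
    define B :: "nat set set set" where "B = {E. card E \<in> S}"
    define bad :: "nat set set set" where "bad = {E. \<not> disjoint E} \<union> {E. real n / 4 \<le> real (card E)}"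
    have count: "measure_pmf.prob (edge_count (l n) n) X = measure_pmf.prob Q {E. card E \<in> X}" for X
      by (simp add: Q_def p_def vimage_def flip: map_card_binomial_edges[OF p, unfolded p_def])
    have good: "E \<in> A \<longleftrightarrow> E \<in> B" if "E \<in> set_pmf Q" "E \<notin> bad" for E
    proof -
      have "4 * card E < n" using that(2) by (simp add: bad_def)
      then have "2 * card E + w \<le> n" using n by linarith
      then show ?thesis using S[of E n] that set_pmf_binomial_edges
        by (auto simp: A_def B_def bad_def Q_def)
    qed
    have "measure_pmf.prob Q X \<le> measure_pmf.prob Q Y + measure_pmf.prob Q bad"
      if "X \<inter> set_pmf Q \<subseteq> Y \<union> bad" for X Y
    proof -
      have "measure_pmf.prob Q X = measure_pmf.prob Q (X \<inter> set_pmf Q)"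
        by (simp add: measure_Int_set_pmf)
      also have "\<dots> \<le> measure_pmf.prob Q (Y \<union> bad)"
        using that by (intro measure_pmf.finite_measure_mono) auto
      also have "\<dots> \<le> measure_pmf.prob Q Y + measure_pmf.prob Q bad"
        by (rule measure_Un_le) auto
      finally show ?thesis .
    qed
    moreover have "A \<inter> set_pmf Q \<subseteq> B \<union> bad" "B \<inter> set_pmf Q \<subseteq> A \<union> bad" using good by auto
    ultimately have "measure_pmf.prob Q A \<le> measure_pmf.prob Q B + measure_pmf.prob Q bad"
      "measure_pmf.prob Q B \<le> measure_pmf.prob Q A + measure_pmf.prob Q bad" by blast+
    then have "\<bar>measure_pmf.prob Q A - measure_pmf.prob Q B\<bar> \<le> measure_pmf.prob Q bad"
      by linarith
    also have "\<dots> \<le> measure_pmf.prob Q {E. \<not> disjoint E} + measure_pmf.prob Q {E. real n / 4 \<le> real (card E)}"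
      unfolding bad_def by (rule measure_Un_le) auto
    also have "measure_pmf.prob Q {E. \<not> disjoint E} \<le> real n ^ 3 * p\<^sup>2"
      unfolding Q_def by (rule prob_not_matching[OF p])
    also have "real n ^ 3 * p\<^sup>2 \<le> 16 * ((l n)\<^sup>2 / real n)"
    proof -
      have "p \<le> l n / real (n choose 2)"
        unfolding p_def edge_prob_def using l(1)[of n] n
        by (intro divide_left_mono) (auto intro!: mult_pos_pos add_pos_nonneg)
      also have "\<dots> \<le> l n / (real n ^ 2 / 4)"
        using l(1)[of n] n choose_two_ge[of n] by (intro divide_left_mono) auto
      finally have "p\<^sup>2 \<le> (l n / (real n ^ 2 / 4))\<^sup>2"
        using p by (intro power_mono) auto
      then have "real n ^ 3 * p\<^sup>2 \<le> real n ^ 3 * (l n / (real n ^ 2 / 4))\<^sup>2"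
        by (intro mult_left_mono) auto
      also have "\<dots> = 16 * ((l n)\<^sup>2 / real n)"
        using n by (simp add: power2_eq_square power3_eq_cube field_simps)
      finally show ?thesis .
    qed
    also have "measure_pmf.prob Q {E. real n / 4 \<le> real (card E)} \<le> l n / (real n / 4)"
      using edge_count_Markov[OF l(1), of "real n / 4" n n] n count[of "{k. real n / 4 \<le> real k}"] by simp
    also have "l n / (real n / 4) \<le> 4 * ((l n)\<^sup>2 / real n) + 4 * (1 / real n)"
    proof -
      \<comment> \<open>This absorbs the linear Markov term into the quadratic one, at the cost of
        \<open>4 / n\<close>.\<close>
      have "l n \<le> (l n)\<^sup>2 + 1"
        using sum_power2_ge_zero[of "l n - 1" "l n"] by (simp add: power2_eq_square algebra_simps)
      then show ?thesis using n by (simp add: field_simps)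
    qed
    finally have "\<bar>measure_pmf.prob Q A - measure_pmf.prob Q B\<bar> \<le> 20 * ((l n)\<^sup>2 / real n) + 4 * (1 / real n)"
      by simp
    then show "norm (measure_pmf.prob (binomial_random_graph n (edge_prob (l n) n)) {M. M \<Turnstile> \<phi>} -
        measure_pmf.prob (edge_count (l n) n) S) \<le> 20 * ((l n)\<^sup>2 / real n) + 4 * (1 / real n)"
      by (simp add: count prob_models_binomial_random_graph A_def B_def Q_def p_def)
  qed
qed

section \<open>Classes modulo null sequences\<close>

lemma norm_linf_proj_le:
  assumes "\<And>n. \<bar>apply_bcontfun x n\<bar> \<le> c"
  shows "norm (linf_proj x) \<le> c"
  unfolding norm_linf_mod_c0.abs_eq limsup_abs_le_iff
proof (intro allI impI always_eventually)
  fix e :: real and n assume "e > 0"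
  then show "\<bar>apply_bcontfun x n\<bar> < c + e" using assms[of n] by linarith
qed

text \<open>Serves to bound quotient norms from below using only the indices at which
  \<open>l\<close> takes one given value.\<close>

lemma le_norm_linf_proj:
  assumes r: "strict_mono r" and c: "\<forall>\<^sub>F n in sequentially. c \<le> \<bar>apply_bcontfun x (r n)\<bar>"
  shows "c \<le> norm (linf_proj x)"
  unfolding norm_linf_mod_c0.abs_eq
proof (rule field_le_epsilon)
  fix e :: real assume "e > 0"
  then have "\<forall>\<^sub>F n in sequentially. \<bar>apply_bcontfun x (r n)\<bar> < limsup_abs x + e"
    by (intro eventually_subseq[OF r] limsup_abs_less)
  with c have "\<forall>\<^sub>F n in sequentially. c \<le> limsup_abs x + e"
    by eventually_elim linarith
  then show "c \<le> limsup_abs x + e" by simp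
qed

lemma linf_proj_eq_0_iff: "linf_proj x = 0 \<longleftrightarrow> (\<lambda>n. apply_bcontfun x n) \<longlonglongrightarrow> 0"
  unfolding zero_linf_mod_c0.abs_eq linf_proj_eq_iff c0_def by simp

lemma linf_proj_diff: "linf_proj (x - y) = linf_proj x - linf_proj y"
  using linear_diff[OF linear_linf_proj] .

text \<open>A coincidence \<open>u i = u j\<close> is itself a nontrivial relation, with
  coefficients \<open>1\<close> and \<open>-1\<close>; this is why injectivity, and with it the
  cardinality of the image, comes along.\<close>

lemma independent_family:
  fixes u :: "'i \<Rightarrow> 'a :: real_vector"
  assumes fin: "finite I"
    and zero: "\<And>c k. (\<Sum>k\<in>I. c k *\<^sub>R u k) = 0 \<Longrightarrow> k \<in> I \<Longrightarrow> c k = 0"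
  shows "inj_on u I" "independent (u ` I)"
proof -
  show inj: "inj_on u I"
  proof (rule inj_onI, rule ccontr)
    fix i j assume ij: "i \<in> I" "j \<in> I" "u i = u j" "i \<noteq> j"
    let ?c = "\<lambda>k. (if k = i then 1 else 0) - (if k = j then 1 else 0) :: real"
    have "(\<Sum>k\<in>I. ?c k *\<^sub>R u k) = (\<Sum>k\<in>I. if k = i then u k else 0) - (\<Sum>k\<in>I. if k = j then u k else 0)"
      unfolding sum_subtractf[symmetric] by (rule sum.cong) auto
    also have "\<dots> = 0" using ij fin by simp
    finally have "?c i = 0" using ij(1) by (rule zero)
    then show False using ij(4) by simp
  qed
  show "independent (u ` I)"
  proof (rule real_vector.independent_if_scalars_zero)
    fix f x assume "(\<Sum>x\<in>u ` I. f x *\<^sub>R x) = 0" "x \<in> u ` I"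
    then show "f x = 0"
      using zero[of "\<lambda>k. f (u k)"] by (auto simp: sum.reindex[OF inj])
  qed (use fin in simp)
qed

section \<open>Probabilities of sets of edge counts\<close>

definition count_seq :: "(nat \<Rightarrow> real) \<Rightarrow> nat set \<Rightarrow> nat \<Rightarrow>\<^sub>C real" where
  "count_seq l S = Bcontfun (\<lambda>n. measure_pmf.prob (edge_count (l n) n) S)"

lemma apply_count_seq: "apply_bcontfun (count_seq l S) n = measure_pmf.prob (edge_count (l n) n) S"
proof -
  have "(\<lambda>n. measure_pmf.prob (edge_count (l n) n) S) \<in> bcontfun"
    by (auto simp: bcontfun_def bounded_iff intro!: exI[of _ 1])
  then show ?thesis by (simp add: count_seq_def Bcontfun_inverse)
qed

abbreviation count_class :: "(nat \<Rightarrow> real) \<Rightarrow> nat set \<Rightarrow> linf_mod_c0" where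
  "count_class l S \<equiv> linf_proj (count_seq l S)"

text \<open>The part of \<open>S\<close> cut off lies in the tail from \<open>K + 1\<close> on,
  which Markov's inequality bounds uniformly in \<open>S\<close> and \<open>n\<close>.\<close>

lemma prob_edge_count_truncate:
  assumes l: "l \<ge> 0"
  shows "\<bar>measure_pmf.prob (edge_count l n) S - measure_pmf.prob (edge_count l n) (S \<inter> {..K})\<bar>
    \<le> l / (real K + 1)"
proof -
  let ?P = "measure_pmf.prob (edge_count l n)"
  have "?P ((S \<inter> {..K}) \<union> (S - {..K})) = ?P (S \<inter> {..K}) + ?P (S - {..K})"
    by (rule measure_pmf.finite_measure_Union) auto
  then have "?P S = ?P (S \<inter> {..K}) + ?P (S - {..K})"
    by (simp add: Int_Diff_Un)
  moreover have "?P (S - {..K}) \<le> ?P {k. real K + 1 \<le> real k}"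
    by (intro measure_pmf.finite_measure_mono) auto
  moreover have "\<dots> \<le> l / (real K + 1)"
    by (rule edge_count_Markov[OF l]) simp
  ultimately show ?thesis by (simp add: measure_nonneg)
qed

text \<open>Finite sets converge termwise by the Poisson limit, and the tails are uniformly small.
  Cauchy's criterion then gives a limit for arbitrary \<open>S\<close> without identifying
  it.\<close>

lemma prob_edge_count_convergent:
  assumes l: "l \<ge> 0"
  shows "convergent (\<lambda>n. measure_pmf.prob (edge_count l n) S)"
proof (rule Cauchy_convergent, rule metric_CauchyI)
  let ?P = "\<lambda>n. measure_pmf.prob (edge_count l n)"
  fix e :: real assume e: "e > 0"
  obtain K :: nat where "3 * l / e < real K" using reals_Archimedean2 by blast
  then have K: "l / (real K + 1) < e / 3" using e by (simp add: field_simps)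
  have "(\<lambda>n. \<Sum>k\<in>S \<inter> {..K}. pmf (edge_count l n) k) \<longlonglongrightarrow> (\<Sum>k\<in>S \<inter> {..K}. exp (- l) * l ^ k / fact k)"
    by (intro tendsto_sum edge_count_tendsto_Poisson l)
  then have "Cauchy (\<lambda>n. ?P n (S \<inter> {..K}))"
    by (subst measure_measure_pmf_finite) (auto intro: LIMSEQ_imp_Cauchy)
  then obtain M where M: "\<And>m n. m \<ge> M \<Longrightarrow> n \<ge> M \<Longrightarrow> dist (?P m (S \<inter> {..K})) (?P n (S \<inter> {..K})) < e / 3"
    using e by (meson metric_CauchyD zero_less_divide_iff zero_less_numeral)
  have "dist (?P m S) (?P n S) < e" if "m \<ge> M" "n \<ge> M" for m n
    using M[OF that] K prob_edge_count_truncate[OF l, of m S K] prob_edge_count_truncate[OF l, of n S K]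
    unfolding dist_real_def by linarith
  then show "\<exists>M. \<forall>m\<ge>M. \<forall>n\<ge>M. dist (?P m S) (?P n S) < e" by blast
qed

section \<open>First order complexity in the sparse regime\<close>

locale sparse_regime =
  fixes l :: "nat \<Rightarrow> real"
  assumes nonneg: "l n \<ge> 0"
    and sparse: "(\<lambda>n. (l n)\<^sup>2 / real n) \<longlonglongrightarrow> 0"
begin

abbreviation p :: "nat \<Rightarrow> real" where
  "p n \<equiv> edge_prob (l n) n"

lemma p_bounds: "p n \<in> {0..1}"
  by (rule edge_prob_bounds[OF nonneg])

lemma class_eq_count_class:
  assumes "\<And>n E. E \<subseteq> possible_edges n \<Longrightarrow> disjoint E \<Longrightarrow> 2 * card E + w \<le> n \<Longrightarrow>
      graph_structure n E \<Turnstile> \<phi> \<longleftrightarrow> card E \<in> S"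
  shows "linf_proj (prob_seq (\<lambda>n. binomial_random_graph n (p n)) \<phi>) = count_class l S"
  using prob_models_edge_count[where l = l and \<phi> = \<phi> and S = S and w = w, OF nonneg sparse assms]
  by (simp add: linf_proj_eq_iff c0_def apply_prob_seq apply_count_seq)

text \<open>The set \<open>S\<close> pools the edge counts of suitable models on all vertex sets.
  Since \<open>matchings_models_iff\<close> compares graphs of different order, this one set is
  correct for every \<open>n\<close>.\<close>

lemma FOC_subset_count_classes: "FOC_Gnp p \<subseteq> range (count_class l)"
proof
  fix x assume "x \<in> FOC_Gnp p"
  then obtain \<phi> where \<phi>: "sentence graph_arity \<phi>"
      "x = linf_proj (prob_seq (\<lambda>n. binomial_random_graph n (p n)) \<phi>)"
    by (auto simp: FOC_def)
  define large where "large n E \<longleftrightarrow> E \<subseteq> possible_edges n \<and> disjoint E \<and>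
    2 * card E + card (all_vars \<phi>) \<le> n" for n E
  define S where "S = {card E | n E. large n E \<and> graph_structure n E \<Turnstile> \<phi>}"
  have "graph_structure n E \<Turnstile> \<phi> \<longleftrightarrow> card E \<in> S" if "large n E" for n E
    using that matchings_models_iff[OF \<phi>(1)] unfolding S_def large_def by blast
  then have "x = count_class l S"
    unfolding \<phi>(2) by (intro class_eq_count_class[where w = "card (all_vars \<phi>)"]) (simp add: large_def)
  then show "x \<in> range (count_class l)" by simp
qed

lemma count_class_atLeast_in_FOC: "count_class l {k..} \<in> FOC_Gnp p"
proof -
  have "count_class l {k..} =
      linf_proj (prob_seq (\<lambda>n. binomial_random_graph n (p n)) (many_nonisolated (2 * k) 0))"
    by (rule class_eq_count_class[where w = 0, symmetric])
      (simp add: matching_models_many_nonisolated)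
  then show ?thesis using sentence_many_nonisolated by (auto simp: FOC_def)
qed

text \<open>A point probability is the difference of two consecutive tails, and the tails come from
  sentences.\<close>

lemma count_class_singleton_in_span: "count_class l {k} \<in> span (FOC_Gnp p)"
proof -
  have "count_seq l {k} = count_seq l {k..} - count_seq l {Suc k..}"
  proof (rule bcontfun_eqI)
    fix n
    have "{k..} = {k} \<union> {Suc k..}" by auto
    then have "measure_pmf.prob (edge_count (l n) n) {k..} =
        measure_pmf.prob (edge_count (l n) n) {k} + measure_pmf.prob (edge_count (l n) n) {Suc k..}"
      by (simp only:) (rule measure_pmf.finite_measure_Union, auto)
    then show "apply_bcontfun (count_seq l {k}) n = apply_bcontfun (count_seq l {k..} - count_seq l {Suc k..}) n"
      by (simp add: apply_count_seq)
  qed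
  then show ?thesis
    by (simp add: linf_proj_diff span_diff span_base count_class_atLeast_in_FOC)
qed

text \<open>Along the indices with \<open>l n = a\<close> the relation tends to
  \<open>exp (- a)\<close> times a polynomial in \<open>a\<close> with coefficients
  \<open>c k / fact k\<close>. All \<open>m\<close> elements of \<open>M\<close> are thus roots of a
  polynomial of degree below \<open>m\<close>.\<close>

lemma count_classes_linear_relation:
  assumes M: "finite M" "card M = m" "\<And>a. a \<in> M \<Longrightarrow> infinite {n. l n = a}"
    and rel: "(\<Sum>k<m. c k *\<^sub>R count_class l {k}) = 0" and k: "k < m"
  shows "c k = 0"
proof (rule ccontr)
  assume ck: "c k \<noteq> 0"
  have root: "(\<Sum>i\<le>m - 1. c i / fact i * a ^ i) = 0" if aM: "a \<in> M" for a
  proof -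
    obtain r :: "nat \<Rightarrow> nat" where r: "strict_mono r" "\<And>n. l (r n) = a"
      using infinite_enumerate[OF M(3)[OF aM]] unfolding mem_Collect_eq by blast
    have a: "a \<ge> 0" using nonneg[of "r 0"] r(2) by simp
    have "linf_proj (\<Sum>k<m. c k *\<^sub>R count_seq l {k}) = 0"
      using rel by (simp add: linear_sum[OF linear_linf_proj] linear_scale[OF linear_linf_proj])
    then have "(\<lambda>n. apply_bcontfun (\<Sum>k<m. c k *\<^sub>R count_seq l {k}) n) \<longlonglongrightarrow> 0"
      by (simp only: linf_proj_eq_0_iff)
    moreover have "apply_bcontfun (\<Sum>k\<in>K. c k *\<^sub>R count_seq l {k}) n = (\<Sum>k\<in>K. c k * pmf (edge_count (l n) n) k)"
      if "finite K" for n K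
      using that by (induction K rule: finite_induct) (auto simp: apply_count_seq measure_pmf_single)
    ultimately have "(\<lambda>n. \<Sum>k<m. c k * pmf (edge_count (l n) n) k) \<longlonglongrightarrow> 0" by simp
    from LIMSEQ_subseq_LIMSEQ[OF this r(1)]
    have "(\<lambda>n. \<Sum>k<m. c k * pmf (edge_count a (r n)) k) \<longlonglongrightarrow> 0" by (simp add: o_def r(2))
    moreover have "(\<lambda>n. \<Sum>k<m. c k * pmf (edge_count a n) k) \<longlonglongrightarrow> (\<Sum>k<m. c k * (exp (- a) * a ^ k / fact k))"
      by (intro tendsto_sum tendsto_mult_left edge_count_tendsto_Poisson a)
    from LIMSEQ_subseq_LIMSEQ[OF this r(1)]
    have "(\<lambda>n. \<Sum>k<m. c k * pmf (edge_count a (r n)) k) \<longlonglongrightarrow> (\<Sum>k<m. c k * (exp (- a) * a ^ k / fact k))"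
      by (simp add: o_def)
    ultimately have "(\<Sum>k<m. c k * (exp (- a) * a ^ k / fact k)) = 0"
      using LIMSEQ_unique by blast
    moreover have "(\<Sum>k<m. c k * (exp (- a) * a ^ k / fact k)) = exp (- a) * (\<Sum>k<m. c k / fact k * a ^ k)"
      by (simp add: sum_distrib_left mult_ac)
    \<comment> \<open>Here \<open>k < m\<close> excludes \<open>m = 0\<close>, where the truncated
      difference would be wrong.\<close>
    moreover have "{..<m} = {..m - 1}" using k by auto
    ultimately show ?thesis by simp
  qed
  have "finite {z. (\<Sum>i\<le>m - 1. c i / fact i * z ^ i) = 0} \<and>
      card {z. (\<Sum>i\<le>m - 1. c i / fact i * z ^ i) = 0} \<le> m - 1"
    using ck k by (intro Transcendental.polyfun_rootbound[of "\<lambda>i. c i / fact i" k]) auto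
  moreover have "M \<subseteq> {z. (\<Sum>i\<le>m - 1. c i / fact i * z ^ i) = 0}" using root by auto
  ultimately have "card M \<le> m - 1" using card_mono le_trans by blast
  then show False using M(2) k by simp
qed

lemma independent_count_classes:
  assumes "finite M" "card M = m" "\<And>a. a \<in> M \<Longrightarrow> infinite {n. l n = a}"
  shows "independent ((\<lambda>k. count_class l {k}) ` {..<m})"
    and "card ((\<lambda>k. count_class l {k}) ` {..<m}) = m"
  using independent_family[of "{..<m}" "\<lambda>k. count_class l {k}"]
    count_classes_linear_relation[OF assms] by (auto simp: card_image)

end

section \<open>The three constructions\<close>

text \<open>A basis \<open>C\<close> of \<open>span F\<close> is independent inside
  \<open>span B\<close>, hence finite; only then can \<open>U\<close> be compared with it.\<close>

lemma dim_span_eq_if_sandwiched: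
  fixes F :: "'a :: real_vector set"
  assumes "F \<subseteq> span B" "finite B" "card B \<le> d" and U: "U \<subseteq> span F" "independent U" "card U = d"
  shows "dim (span F) = d"
proof -
  obtain C where C: "C \<subseteq> span F" "independent C" "span F \<subseteq> span C" "card C = dim (span F)"
    using basis_exists by blast
  have "C \<subseteq> span B" using C(1) assms(1) by (meson span_minimal subspace_span subset_trans)
  then have "finite C" "card C \<le> card B"
    using independent_span_bound[OF assms(2) C(2)] by auto
  moreover have "card U \<le> card C"
    using independent_span_bound[OF \<open>finite C\<close> U(2)] U(1) C(3) by auto
  ultimately show ?thesis using assms(3) U(3) C(4) by simp
qed

text \<open>On each residue class modulo \<open>d\<close> the mean is constant and all probabilities
  converge, so the \<open>d\<close> limits determine a class: the indicators of the residue classes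
  span. The \<open>d\<close> values of \<open>l\<close>, each taken infinitely often, give the lower
  bound.\<close>

lemma FOC_dimension:
  assumes d: "d \<ge> 1"
  obtains p :: "nat \<Rightarrow> real" where "\<And>n. p n \<in> {0..1}" "dim (span (FOC_Gnp p)) = d"
proof -
  define l where "l n = real (n mod d)" for n
  interpret sparse_regime l
  proof
    show "(\<lambda>n. (l n)\<^sup>2 / real n) \<longlonglongrightarrow> 0"
    proof (rule Lim_null_comparison)
      show "(\<lambda>n. (real d)\<^sup>2 / real n) \<longlonglongrightarrow> 0" by (rule lim_const_over_n)
      have "(l n)\<^sup>2 \<le> (real d)\<^sup>2" for n
        using d by (intro power_mono) (auto simp: l_def less_imp_le)
      then show "\<forall>\<^sub>F n in sequentially. norm ((l n)\<^sup>2 / real n) \<le> (real d)\<^sup>2 / real n"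
        by (intro always_eventually) (auto simp: divide_right_mono)
    qed
  qed (simp add: l_def)
  define ind where "ind i = Bcontfun (\<lambda>n. if n mod d = i then 1 else 0 :: real)" for i
  have apply_ind: "apply_bcontfun (ind i) n = (if n mod d = i then 1 else 0)" for i n
  proof -
    have "(\<lambda>n. if n mod d = i then 1 else 0 :: real) \<in> bcontfun"
      by (auto simp: bcontfun_def bounded_iff intro!: exI[of _ 1])
    then show ?thesis by (simp add: ind_def Bcontfun_inverse)
  qed
  have "count_class l S \<in> span ((\<lambda>i. linf_proj (ind i)) ` {..<d})" for S
  proof -
    have "\<exists>L. (\<lambda>n. measure_pmf.prob (edge_count (real i) n) S) \<longlonglongrightarrow> L" for i
      using prob_edge_count_convergent[of "real i" S] by (simp add: convergent_def)
    then obtain L where L: "\<And>i. (\<lambda>n. measure_pmf.prob (edge_count (real i) n) S) \<longlonglongrightarrow> L i"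
      by metis
    let ?y = "\<Sum>i<d. L i *\<^sub>R ind i"
    have y: "apply_bcontfun ?y n = L (n mod d)" for n
    proof -
      have "apply_bcontfun (\<Sum>i\<in>I. L i *\<^sub>R ind i) n = (\<Sum>i\<in>I. if n mod d = i then L i else 0)"
        if "finite I" for I
        using that by (induction I rule: finite_induct) (auto simp: apply_ind)
      then show ?thesis using d by simp
    qed
    have "(\<lambda>n. apply_bcontfun (count_seq l S - ?y) n) \<longlonglongrightarrow> 0"
    proof (rule tendstoI)
      fix e :: real assume "e > 0"
      \<comment> \<open>Finitely many residues make the convergence uniform in \<open>i\<close>, so
        \<open>i\<close> may be set to \<open>n mod d\<close> afterwards.\<close>
      then have "\<forall>\<^sub>F n in sequentially. \<forall>i\<in>{..<d}. dist (measure_pmf.prob (edge_count (real i) n) S) (L i) < e"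
        using L by (intro eventually_ball_finite) (auto intro: tendstoD)
      then show "\<forall>\<^sub>F n in sequentially. dist (apply_bcontfun (count_seq l S - ?y) n) 0 < e"
      proof eventually_elim
        case (elim n)
        then show ?case using d by (simp add: y apply_count_seq dist_real_def l_def)
      qed
    qed
    then have "count_class l S = linf_proj ?y" by (simp add: linf_proj_eq_iff c0_def)
    also have "\<dots> = (\<Sum>i<d. L i *\<^sub>R linf_proj (ind i))"
      by (simp add: linear_sum[OF linear_linf_proj] linear_scale[OF linear_linf_proj])
    also have "\<dots> \<in> span ((\<lambda>i. linf_proj (ind i)) ` {..<d})"
      by (intro span_sum span_scale span_base) auto
    finally show ?thesis .
  qed
  then have sub: "FOC_Gnp p \<subseteq> span ((\<lambda>i. linf_proj (ind i)) ` {..<d})"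
    using FOC_subset_count_classes by blast
  have inf: "infinite {n. l n = a}" if "a \<in> real ` {..<d}" for a
  proof -
    obtain i where i: "i < d" "a = real i" using \<open>a \<in> real ` {..<d}\<close> by auto
    have "inj (\<lambda>n. n * d + i)" using d by (auto simp: inj_on_def)
    then have "infinite (range (\<lambda>n. n * d + i))" by (rule range_inj_infinite)
    moreover have "range (\<lambda>n. n * d + i) \<subseteq> {n. l n = a}" using i by (auto simp: l_def)
    ultimately show ?thesis using finite_subset by blast
  qed
  have "card (real ` {..<d}) = d" by (simp add: card_image)
  note ind = independent_count_classes[OF _ this inf]
  have dim: "dim (span (FOC_Gnp p)) = d"
    by (rule dim_span_eq_if_sandwiched[OF sub _ _ _ ind(1) ind(2)])
      (use card_image_le[of "{..<d}"] count_class_singleton_in_span in auto)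
  show ?thesis by (rule that[OF p_bounds dim])
qed

lemma FOC_totally_bounded_infinite_dimensional:
  obtains p :: "nat \<Rightarrow> real" where "\<And>n. p n \<in> {0..1}"
    "totally_bounded (FOC_Gnp p)" "\<not> finite_dimensional (span (FOC_Gnp p))"
proof -
  \<comment> \<open>The first component of the pairing takes every natural number infinitely often,
    so each value \<open>1 / (1 + j)\<close> recurs while the means stay at most
    \<open>1\<close>.\<close>
  define l where "l n = 1 / (1 + real (fst (prod_decode n)))" for n
  have l1: "l n \<le> 1" for n by (simp add: l_def)
  have l0: "l n \<ge> 0" for n by (simp add: l_def)
  interpret sparse_regime l
  proof
    show "(\<lambda>n. (l n)\<^sup>2 / real n) \<longlonglongrightarrow> 0"
    proof (rule Lim_null_comparison)
      show "(\<lambda>n. 1 / real n) \<longlonglongrightarrow> 0" by (rule lim_1_over_n)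
      show "\<forall>\<^sub>F n in sequentially. norm ((l n)\<^sup>2 / real n) \<le> 1 / real n"
        using l0 l1 by (intro always_eventually) (auto intro!: divide_right_mono simp: power_le_one)
    qed
  qed (rule l0)
  have tb: "totally_bounded (FOC_Gnp p)"
    unfolding totally_bounded_metric
  proof (intro allI impI)
    fix e :: real assume e: "e > 0"
    obtain K :: nat where "1 / e < real K" using reals_Archimedean2 by blast
    then have K: "1 / (real K + 1) < e" using e by (simp add: field_simps)
    \<comment> \<open>Truncation at \<open>K\<close> moves every class by at most
      \<open>1 / (K + 1)\<close>, so this finite set is an \<open>e\<close>-net.\<close>
    let ?X = "count_class l ` Pow {..K}"
    have "\<exists>x\<in>?X. dist x y < e" if "y \<in> FOC_Gnp p" for y
    proof -
      obtain S where S: "y = count_class l S" using FOC_subset_count_classes \<open>y \<in> FOC_Gnp p\<close> by auto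
      have "norm (linf_proj (count_seq l S - count_seq l (S \<inter> {..K}))) \<le> 1 / (real K + 1)"
      proof (rule norm_linf_proj_le)
        fix n
        have "l n / (real K + 1) \<le> 1 / (real K + 1)" using l1 by (intro divide_right_mono) auto
        then show "\<bar>apply_bcontfun (count_seq l S - count_seq l (S \<inter> {..K})) n\<bar> \<le> 1 / (real K + 1)"
          using prob_edge_count_truncate[OF l0, of n n S K] by (simp add: apply_count_seq)
      qed
      then have "dist (count_class l (S \<inter> {..K})) y < e"
        using K by (simp add: dist_norm S norm_minus_commute linf_proj_diff)
      then show ?thesis by blast
    qed
    then show "\<exists>X. finite X \<and> FOC_Gnp p \<subseteq> (\<Union>x\<in>X. {y. dist x y < e})"
      by (intro exI[of _ ?X]) auto
  qed
  have inf_dim: "\<not> finite_dimensional (span (FOC_Gnp p))"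
  proof
    assume "finite_dimensional (span (FOC_Gnp p))"
    then obtain B where B: "finite B" "span B = span (FOC_Gnp p)"
      unfolding finite_dimensional_def by blast
    \<comment> \<open>One more independent class than a spanning set of size \<open>card B\<close>
      permits.\<close>
    define m where "m = Suc (card B)"
    let ?M = "(\<lambda>j. 1 / (1 + real j)) ` {..<m}"
    have M: "card ?M = m" by (subst card_image) (auto simp: inj_on_def)
    have inf: "infinite {n. l n = a}" if "a \<in> ?M" for a
    proof -
      obtain j where j: "a = 1 / (1 + real j)" using \<open>a \<in> ?M\<close> by auto
      have "inj (\<lambda>n. prod_encode (j, n))" by (auto simp: inj_on_def)
      then have "infinite (range (\<lambda>n. prod_encode (j, n)))" by (rule range_inj_infinite)
      moreover have "range (\<lambda>n. prod_encode (j, n)) \<subseteq> {n. l n = a}" using j by (auto simp: l_def)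
      ultimately show ?thesis using finite_subset by blast
    qed
    note ind = independent_count_classes[OF _ M inf]
    have "card ((\<lambda>k. count_class l {k}) ` {..<m}) \<le> card B"
      using independent_span_bound[OF B(1) ind(1)] count_class_singleton_in_span B(2) by auto
    then show False using ind(2) by (simp add: m_def)
  qed
  show ?thesis by (rule that[OF p_bounds tb inf_dim])
qed

lemma FOC_not_totally_bounded:
  obtains p :: "nat \<Rightarrow> real" where "\<And>n. p n \<in> {0..1}" "\<not> totally_bounded (FOC_Gnp p)"
proof -
  \<comment> \<open>The means must be unbounded but grow slowly; the fourth root keeps
    \<open>(l n)\<^sup>2\<close> below \<open>sqrt n\<close>.\<close>
  define h where "h n = nat \<lfloor>sqrt (sqrt (real n))\<rfloor>" for n
  define l where "l n = real (fst (prod_decode (h n)))" for n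
  have l0: "l n \<ge> 0" for n by (simp add: l_def)
  have l_le: "(l n)\<^sup>2 \<le> sqrt (real n)" for n
  proof -
    have "fst (prod_decode (h n)) \<le> h n"
      using le_prod_encode_1[of "fst (prod_decode (h n))" "snd (prod_decode (h n))"] by simp
    then have "l n \<le> real (h n)" by (simp add: l_def)
    also have "\<dots> \<le> sqrt (sqrt (real n))" by (simp add: h_def)
    finally have "(l n)\<^sup>2 \<le> (sqrt (sqrt (real n)))\<^sup>2" using l0 by (rule power_mono)
    then show ?thesis by simp
  qed
  interpret sparse_regime l
  proof
    show "(\<lambda>n. (l n)\<^sup>2 / real n) \<longlonglongrightarrow> 0"
    proof (rule Lim_null_comparison)
      show "(\<lambda>n. inverse (sqrt (real n))) \<longlonglongrightarrow> 0"
        by (intro tendsto_inverse_0_at_top filterlim_compose[OF sqrt_at_top] filterlim_real_sequentially)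
      have "(l n)\<^sup>2 / real n \<le> inverse (sqrt (real n))" for n
      proof -
        have "(l n)\<^sup>2 / real n \<le> sqrt (real n) / real n" by (intro divide_right_mono l_le) simp
        also have "\<dots> = inverse (sqrt (real n))" by (simp add: sqrt_divide_self_eq)
        finally show ?thesis .
      qed
      then show "\<forall>\<^sub>F n in sequentially. norm ((l n)\<^sup>2 / real n) \<le> inverse (sqrt (real n))"
        by (intro always_eventually) auto
    qed
  qed (rule l0)
  have inf: "infinite {n. l n = real i}" for i
  proof -
    \<comment> \<open>At fourth powers the rounding is exact, so every code of a pair is
      reached.\<close>
    have "h ((m\<^sup>2)\<^sup>2) = m" for m
      by (simp only: h_def of_nat_power real_sqrt_abs abs_power2 abs_of_nat floor_of_nat nat_int)
    then have "inj (\<lambda>m. ((prod_encode (i, m))\<^sup>2)\<^sup>2)"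
      by (intro injI) (metis prod_encode_eq prod.inject)
    then have "infinite (range (\<lambda>m. ((prod_encode (i, m))\<^sup>2)\<^sup>2))" by (rule range_inj_infinite)
    moreover have "range (\<lambda>m. ((prod_encode (i, m))\<^sup>2)\<^sup>2) \<subseteq> {n. l n = real i}"
      using \<open>\<And>m. h ((m\<^sup>2)\<^sup>2) = m\<close> by (auto simp: l_def)
    ultimately show ?thesis using finite_subset by blast
  qed
  have not_tb: "\<not> totally_bounded (FOC_Gnp p)"
  proof
    assume "totally_bounded (FOC_Gnp p)"
    then have "\<exists>X. finite X \<and> FOC_Gnp p \<subseteq> (\<Union>x\<in>X. {y. dist x y < 1 / 4})"
      unfolding totally_bounded_metric by (rule allE[of _ "1 / 4"]) simp
    then obtain X where X: "finite X" "FOC_Gnp p \<subseteq> (\<Union>x\<in>X. {y. dist x y < 1 / 4})"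
      by (elim exE conjE)
    \<comment> \<open>By the pigeonhole principle one ball contains infinitely many tail classes.
      The choices below are made in the order \<open>k\<close>, \<open>i\<close>,
      \<open>m\<close>.\<close>
    have "\<forall>k\<in>UNIV. \<exists>x\<in>X. dist x (count_class l {k..}) < 1 / 4"
      using X(2) count_class_atLeast_in_FOC by blast
    from pigeonhole_infinite_rel[OF infinite_UNIV_nat X(1) this]
    obtain x where x: "infinite {k. dist x (count_class l {k..}) < 1 / 4}" by auto
    then obtain k where k: "dist x (count_class l {k..}) < 1 / 4"
      using not_finite_existsD by blast
    \<comment> \<open>A Poisson variable of large mean \<open>i\<close> is rarely below the fixed
      \<open>k\<close>.\<close>
    have "(\<lambda>i. \<Sum>j<k. real i ^ j / exp (real i) * (1 / fact j)) \<longlonglongrightarrow> (\<Sum>j<k. 0 * (1 / fact j))"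
      by (intro tendsto_sum tendsto_mult_right filterlim_compose[OF tendsto_power_div_exp_0]
          filterlim_real_sequentially)
    then have "\<forall>\<^sub>F i in sequentially. (\<Sum>j<k. real i ^ j / exp (real i) * (1 / fact j)) < 1 / 4"
      by (intro order_tendstoD(2)[where a = "1/4"]) auto
    then obtain i :: nat where i: "(\<Sum>j<k. real i ^ j / exp (real i) * (1 / fact j)) < 1 / 4"
      using eventually_happens'[OF sequentially_bot] by blast
    \<comment> \<open>For mean \<open>i\<close> Markov's inequality then gives \<open>{m..}\<close>
      probability at most \<open>1 / 4\<close>; the summand \<open>1\<close> keeps \<open>m\<close>
      positive.\<close>
    obtain m where m: "dist x (count_class l {m..}) < 1 / 4" "m \<ge> 4 * i + 1"
    proof -
      have "\<exists>m\<ge>4 * i + 1. m \<in> {k. dist x (count_class l {k..}) < 1 / 4}"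
        using x unfolding infinite_nat_iff_unbounded_le by blast
      then show ?thesis using that by blast
    qed
    obtain r :: "nat \<Rightarrow> nat" where r: "strict_mono r" "\<And>n. l (r n) = real i"
      using infinite_enumerate[OF inf[of i]] unfolding mem_Collect_eq by blast
    have "(\<lambda>n. \<Sum>j<k. pmf (edge_count (real i) n) j) \<longlonglongrightarrow> (\<Sum>j<k. exp (- real i) * real i ^ j / fact j)"
      by (intro tendsto_sum edge_count_tendsto_Poisson) simp
    moreover have "(\<Sum>j<k. exp (- real i) * real i ^ j / fact j) < 1 / 4"
      using i by (simp add: exp_minus field_simps)
    ultimately have "\<forall>\<^sub>F n in sequentially. (\<Sum>j<k. pmf (edge_count (real i) n) j) < 1 / 4"
      by (rule order_tendstoD(2))
    then have "\<forall>\<^sub>F n in sequentially. (\<Sum>j<k. pmf (edge_count (real i) (r n)) j) < 1 / 4"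
      by (rule eventually_subseq[OF r(1)])
    \<comment> \<open>Where \<open>l\<close> equals \<open>i\<close>, one tail eventually has
      probability above \<open>3 / 4\<close> and the other at most \<open>1 / 4\<close>, whereas two
      points of the ball are less than \<open>1 / 2\<close> apart.\<close>
    then have "\<forall>\<^sub>F n in sequentially. 1 / 2 \<le> \<bar>apply_bcontfun (count_seq l {k..} - count_seq l {m..}) (r n)\<bar>"
    proof eventually_elim
      case (elim n)
      let ?P = "measure_pmf.prob (edge_count (real i) (r n))"
      have "?P {..<k} < 1 / 4" using elim by (simp add: measure_measure_pmf_finite)
      moreover have "?P {k..} = 1 - ?P {..<k}"
        using measure_pmf.prob_compl[of "{..<k}" "edge_count (real i) (r n)"]
        by (simp add: Compl_eq_Diff_UNIV[symmetric])
      moreover have "?P {m..} \<le> real i / real m"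
        using edge_count_Markov[of "real i" "real m" "r n"] m(2) by (simp add: atLeast_def)
      moreover have "real i / real m \<le> 1 / 4" using m(2) by (simp add: field_simps)
      ultimately have "1 / 2 \<le> \<bar>?P {k..} - ?P {m..}\<bar>" by linarith
      then show ?case by (simp only: apply_count_seq r(2) minus_bcontfun.rep_eq)
    qed
    then have "1 / 2 \<le> norm (linf_proj (count_seq l {k..} - count_seq l {m..}))"
      by (rule le_norm_linf_proj[OF r(1)])
    then have "1 / 2 \<le> dist (count_class l {k..}) (count_class l {m..})"
      by (simp add: dist_norm linf_proj_diff)
    then show False
      using dist_triangle2[of "count_class l {k..}" "count_class l {m..}" x] k m(1)
      by (simp add: dist_commute)
  qed
  show ?thesis by (rule that[OF p_bounds not_tb])
qed

theorem theorem1: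
  shows "(\<forall>d::nat. d \<ge> 1 \<longrightarrow> (\<exists>p :: nat \<Rightarrow> real. (\<forall>n. p n \<in> {0..1}) \<and>
            dim (span (FOC_Gnp p)) = d)) \<and>
         (\<exists>p :: nat \<Rightarrow> real. (\<forall>n. p n \<in> {0..1}) \<and>
            totally_bounded (FOC_Gnp p) \<and> \<not> finite_dimensional (span (FOC_Gnp p))) \<and>
         (\<exists>p :: nat \<Rightarrow> real. (\<forall>n. p n \<in> {0..1}) \<and>
            \<not> totally_bounded (FOC_Gnp p))"
proof (intro conjI allI impI)
  fix d :: nat assume "d \<ge> 1"
  then show "\<exists>p :: nat \<Rightarrow> real. (\<forall>n. p n \<in> {0..1}) \<and> dim (span (FOC_Gnp p)) = d"
    by (rule FOC_dimension) blast
next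
  show "\<exists>p :: nat \<Rightarrow> real. (\<forall>n. p n \<in> {0..1}) \<and>
      totally_bounded (FOC_Gnp p) \<and> \<not> finite_dimensional (span (FOC_Gnp p))"
    by (rule FOC_totally_bounded_infinite_dimensional) blast
next
  show "\<exists>p :: nat \<Rightarrow> real. (\<forall>n. p n \<in> {0..1}) \<and> \<not> totally_bounded (FOC_Gnp p)"
    by (rule FOC_not_totally_bounded) blast
qed

end
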